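(* Let $n\ge 1$ be an integer and let $B$ be the open unit ball of $\mathbb{R}^{n+1}$. Let $U$ be a harmonic function in $B$ with $U(0)=0$ and $$U(z)\le (1-|z|)^{-n},\quad z\in B .$$ Then $$|U(z)|\le C(1-|z|)^{-n}\left(\log\frac{1}{1-|z|}\right)^{n+1},\quad |z|>\tfrac12,\ z\in B,$$ where $C$ depends on $n$ only. *)

theory Defs
  imports "HOL-Analysis.Analysis"
begin

definition partial_deriv :: "'a \<Rightarrow> ('a::euclidean_space \<Rightarrow> real) \<Rightarrow> 'a \<Rightarrow> real" where
  "partial_deriv b f x = frechet_derivative f (at x) b"

definition laplacian :: "('a::euclidean_space \<Rightarrow> real) \<Rightarrow> 'a \<Rightarrow> real" where
  "laplacian f x = (\<Sum>b\<in>Basis. partial_deriv b (partial_deriv b f) x)"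

text \<open>
  The class $C^2(S)$ for open \<open>S\<close>. Differentiability is required separately because
  \<^const>\<open>frechet_derivative\<close> is an arbitrary value where the derivative does not exist.
\<close>
definition C2_on :: "'a set \<Rightarrow> ('a::euclidean_space \<Rightarrow> real) \<Rightarrow> bool" where
  "C2_on S f \<longleftrightarrow>
     open S \<and> f differentiable_on S \<and>
     (\<forall>b\<in>Basis. partial_deriv b f differentiable_on S) \<and>
     (\<forall>b\<in>Basis. \<forall>c\<in>Basis. continuous_on S (partial_deriv c (partial_deriv b f)))"

definition harmonic_on :: "'a set \<Rightarrow> ('a::euclidean_space \<Rightarrow> real) \<Rightarrow> bool" where
  "harmonic_on S f \<longleftrightarrow> C2_on S f \<and> (\<forall>x\<in>S. laplacian f x = 0)"

end

theory Submission
  imports Defs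
begin

text \<open>
  Write \<open>\<delta> = 1 - norm z0\<close>. The hypothesis bounds \<open>U\<close> from above, so only a lower bound at \<open>z0\<close> is at stake.
  Combining the Poisson formula with \<open>U 0 = 0\<close> on a concentric sphere would give only
  \<open>- U z0 \<le> C / \<delta> ^ (2 * n)\<close>, because on that sphere \<open>U\<close> is known to be at most \<open>1 / \<delta> ^ n\<close> everywhere. The gain
  comes from a domain \<open>\<Omega>\<close> whose boundary approaches the unit sphere only near \<open>z0\<close>: at distance \<open>t\<close> from
  \<open>z0\<close> it keeps a distance of order at least \<open>t / N\<close> from the sphere, where \<open>N\<close> is of order \<open>ln (1 / \<delta>)\<close>. The slope \<open>1 / N\<close>
  is small enough for \<open>\<Omega>\<close> to behave like a half space at all scales between \<open>\<delta>\<close> and \<open>1\<close>.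

  Everything is done with explicit harmonic functions. Let \<open>P\<close> be the Poisson kernel with pole \<open>p\<close> at a
  distance of order \<open>\<delta>\<close> from \<open>z0\<close>, and let \<open>S\<close> be the sum of \<open>N\<close> Poisson kernels whose poles are moved
  outward from \<open>p\<close> by \<open>\<delta>\<close>, \<open>2 * \<delta>\<close>, \<open>4 * \<delta>\<close>, and so on up to a distance of order \<open>1\<close>. At distance \<open>t\<close> from \<open>p\<close> the kernel of
  scale about \<open>t\<close> gives \<open>S \<ge> c / t ^ n\<close>, up to the boundary (lemma \<open>poisson_kernel_ge_at_comparable_scale\<close>),
  while \<open>S 0\<close> is at most of order \<open>N\<close>. Put \<open>v = P - \<eta> * S\<close> with \<open>\<eta>\<close> of order \<open>1 / N\<close>, so that \<open>v 0 \<ge> 1 / 2\<close>, and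
  let \<open>\<Omega>\<close> be the set \<open>v > 0\<close> with a ball of radius of order \<open>\<delta>\<close> about \<open>z0\<close> removed. Where \<open>v = 0\<close>, the equality
  \<open>P = \<eta> * S\<close> forces the distance to the unit sphere to be at least of order \<open>\<eta> * t\<close>; hence
  \<open>U \<le> A * S\<close> there, with \<open>A\<close> of order \<open>N ^ n\<close>.

  If \<open>- U \<ge> m > 0\<close> on the removed ball, then \<open>A * S - U - m' * v\<close> is nonnegative on the boundary of \<open>\<Omega>\<close> for
  some \<open>m'\<close> of order \<open>m * \<delta> ^ n\<close>, since \<open>v\<close> is at most of order \<open>1 / \<delta> ^ n\<close> off that ball. The minimum principle
  (lemma \<open>minimum_principle\<close>) at the origin, where \<open>U\<close> vanishes, yields \<open>m' \<le> 2 * A * S 0\<close>. Thus \<open>m\<close> is at most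
  of order \<open>N ^ (n + 1) / \<delta> ^ n\<close>. Finally a Harnack inequality (lemma \<open>harnack_ball\<close>), which comes from the mean value
  property over balls, compares \<open>- U z0\<close> with \<open>m\<close>.
\<close>

section \<open>Second derivatives along lines and the minimum principle\<close>

text \<open>
  The Laplacian is treated one coordinate line at a time: this relation is visibly stable under
  linear combinations and can be checked for Poisson kernels by calculus in one variable.
\<close>
definition has_second_deriv :: "('a::real_normed_vector \<Rightarrow> real) \<Rightarrow> 'a \<Rightarrow> 'a \<Rightarrow> real \<Rightarrow> bool" where
  "has_second_deriv f x b D \<longleftrightarrow>
     (\<exists>g. (\<forall>\<^sub>F t in nhds 0. ((\<lambda>t. f (x + t *\<^sub>R b)) has_real_derivative g t) (at t)) \<and>
          (g has_real_derivative D) (at 0))"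

definition has_laplacian :: "('a::euclidean_space \<Rightarrow> real) \<Rightarrow> 'a \<Rightarrow> real \<Rightarrow> bool" where
  "has_laplacian f x L \<longleftrightarrow>
     (\<exists>D. (\<forall>b\<in>Basis. has_second_deriv f x b (D b)) \<and> L = (\<Sum>b\<in>Basis. D b))"

lemma has_second_deriv_add:
  assumes "has_second_deriv f x b D" "has_second_deriv h x b E"
  shows "has_second_deriv (\<lambda>y. f y + h y) x b (D + E)"
proof -
  obtain g1 g2 where g:
    "\<forall>\<^sub>F t in nhds 0. ((\<lambda>t. f (x + t *\<^sub>R b)) has_real_derivative g1 t) (at t)"
    "(g1 has_real_derivative D) (at 0)"
    "\<forall>\<^sub>F t in nhds 0. ((\<lambda>t. h (x + t *\<^sub>R b)) has_real_derivative g2 t) (at t)"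
    "(g2 has_real_derivative E) (at 0)"
    using assms unfolding has_second_deriv_def by blast
  have "\<forall>\<^sub>F t in nhds 0. ((\<lambda>t. f (x + t *\<^sub>R b) + h (x + t *\<^sub>R b)) has_real_derivative g1 t + g2 t) (at t)"
    using g(1,3) by eventually_elim (rule DERIV_add)
  with DERIV_add[OF g(2,4)] show ?thesis
    unfolding has_second_deriv_def by (intro exI[of _ "\<lambda>t. g1 t + g2 t"]) simp
qed

lemma has_second_deriv_cmult:
  assumes "has_second_deriv f x b D"
  shows "has_second_deriv (\<lambda>y. c * f y) x b (c * D)"
proof -
  obtain g1 where g:
    "\<forall>\<^sub>F t in nhds 0. ((\<lambda>t. f (x + t *\<^sub>R b)) has_real_derivative g1 t) (at t)"
    "(g1 has_real_derivative D) (at 0)"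
    using assms unfolding has_second_deriv_def by blast
  have "\<forall>\<^sub>F t in nhds 0. ((\<lambda>t. c * f (x + t *\<^sub>R b)) has_real_derivative c * g1 t) (at t)"
    using g(1) by eventually_elim (rule DERIV_cmult)
  with DERIV_cmult[OF g(2)] show ?thesis
    unfolding has_second_deriv_def by (intro exI[of _ "\<lambda>t. c * g1 t"]) simp
qed

lemma has_laplacian_add:
  "has_laplacian f x K \<Longrightarrow> has_laplacian h x L \<Longrightarrow> has_laplacian (\<lambda>y. f y + h y) x (K + L)"
  unfolding has_laplacian_def
  by (elim exE conjE, rule_tac x="\<lambda>b. D b + Da b" in exI)
     (auto intro: has_second_deriv_add simp: sum.distrib)

lemma has_laplacian_cmult:
  "has_laplacian f x L \<Longrightarrow> has_laplacian (\<lambda>y. c * f y) x (c * L)"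
  unfolding has_laplacian_def
  by (elim exE conjE, rule_tac x="\<lambda>b. c * D b" in exI)
     (auto intro: has_second_deriv_cmult simp: sum_distrib_left)

lemma has_laplacian_zero: "has_laplacian (\<lambda>y. 0) x 0"
  unfolding has_laplacian_def has_second_deriv_def
  by (intro exI[of _ "\<lambda>_. 0"]) (auto intro!: exI[of _ "\<lambda>_. 0::real"])

lemma has_laplacian_sum:
  assumes "finite I" "\<And>i. i \<in> I \<Longrightarrow> has_laplacian (f i) x 0"
  shows "has_laplacian (\<lambda>y. \<Sum>i\<in>I. f i y) x 0"
  using assms
proof (induction I)
  case empty
  then show ?case by (simp add: has_laplacian_zero)
next
  case (insert i I)
  then have "has_laplacian (\<lambda>y. f i y + (\<Sum>i\<in>I. f i y)) x (0 + 0)"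
    by (intro has_laplacian_add) auto
  with insert show ?case by simp
qed

lemma norm_square_along_basis:
  fixes x :: "'a::euclidean_space"
  assumes "b \<in> Basis"
  shows "(norm (x + t *\<^sub>R b))\<^sup>2 = (norm x)\<^sup>2 + 2 * t * (x \<bullet> b) + t\<^sup>2"
proof -
  have "b \<bullet> b = 1" using assms by simp
  then show ?thesis
    unfolding power2_norm_eq_inner
    by (simp add: inner_add_left inner_add_right inner_commute[of b x] power2_eq_square distrib_left)
qed

lemma has_laplacian_norm_square:
  "has_laplacian (\<lambda>y. (norm y)\<^sup>2) (x::'a::euclidean_space) (2 * DIM('a))"
proof -
  have "has_second_deriv (\<lambda>y. (norm y)\<^sup>2) x b 2" if "b \<in> Basis" for b
    unfolding has_second_deriv_def
  proof (intro exI conjI always_eventually allI)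
    have *: "(\<lambda>t. (norm (x + t *\<^sub>R b))\<^sup>2) = (\<lambda>t. (norm x)\<^sup>2 + 2 * t * (x \<bullet> b) + t\<^sup>2)"
      using that by (simp add: norm_square_along_basis)
    show "((\<lambda>t. (norm (x + t *\<^sub>R b))\<^sup>2) has_real_derivative 2 * (x \<bullet> b) + 2 * t) (at t)" for t
      unfolding * by (auto intro!: derivative_eq_intros)
    show "((\<lambda>t. 2 * (x \<bullet> b) + 2 * t) has_real_derivative 2) (at 0)"
      by (auto intro!: derivative_eq_intros)
  qed
  then show ?thesis
    unfolding has_laplacian_def by (intro exI[of _ "\<lambda>_. 2"]) simp
qed

lemma has_second_deriv_nonneg_at_local_min:
  assumes "has_second_deriv f x b D"
    and "\<forall>\<^sub>F t in nhds 0. f x \<le> f (x + t *\<^sub>R b)"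
  shows "0 \<le> D"
proof (rule ccontr)
  assume "\<not> 0 \<le> D"
  obtain g where g:
    "\<forall>\<^sub>F t in nhds 0. ((\<lambda>t. f (x + t *\<^sub>R b)) has_real_derivative g t) (at t)"
    "(g has_real_derivative D) (at 0)"
    using assms unfolding has_second_deriv_def by blast
  obtain e where e: "e > 0"
    "\<And>t. \<bar>t\<bar> < e \<Longrightarrow> ((\<lambda>t. f (x + t *\<^sub>R b)) has_real_derivative g t) (at t)"
    "\<And>t. \<bar>t\<bar> < e \<Longrightarrow> f x \<le> f (x + t *\<^sub>R b)"
    using eventually_conj[OF g(1) assms(2)] unfolding eventually_nhds_metric dist_real_def by auto
  have "g 0 = 0"
    using DERIV_local_min[OF e(2)[of 0] e(1)] e by auto
  obtain d where d: "d > 0" "\<And>h. 0 < h \<Longrightarrow> h < d \<Longrightarrow> g h < 0"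
    using DERIV_neg_dec_right[OF g(2)] \<open>\<not> 0 \<le> D\<close> \<open>g 0 = 0\<close> by auto
  define h where "h = min e d / 2"
  have h: "0 < h" "h < e" "h < d" using e d by (auto simp: h_def)
  obtain z where z: "0 < z" "z < h"
    "f (x + h *\<^sub>R b) - f (x + 0 *\<^sub>R b) = (h - 0) * g z"
    using MVT2[of 0 h "\<lambda>t. f (x + t *\<^sub>R b)" g] e(2) h by auto
  have "h * g z < 0" using d(2)[of z] z h by (simp add: mult_pos_neg)
  with z e(3)[of h] h show False by simp
qed

text \<open>
  Subtracting \<open>e * (norm y)\<^sup>2\<close> makes the Laplacian strictly negative, so that an interior minimum is
  impossible; \<open>e\<close> is taken so small that a negative value of \<open>f\<close> stays below all boundary values.
\<close>
lemma minimum_principle: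
  fixes f :: "'a::euclidean_space \<Rightarrow> real"
  assumes "open S" "bounded S" and cont: "continuous_on (closure S) f"
    and lap: "\<And>x. x \<in> S \<Longrightarrow> has_laplacian f x 0"
    and bd: "\<And>x. x \<in> frontier S \<Longrightarrow> 0 \<le> f x"
    and "x \<in> S"
  shows "0 \<le> f x"
proof (rule ccontr)
  assume neg: "\<not> 0 \<le> f x"
  obtain R where R: "R > 0" "\<And>y. y \<in> closure S \<Longrightarrow> norm y \<le> R"
    using bounded_closure[OF \<open>bounded S\<close>] unfolding bounded_pos by blast
  define e where "e = - f x / (2 * R\<^sup>2)"
  have e: "e > 0" "e * R\<^sup>2 = - f x / 2"
    using neg R by (auto simp: e_def field_simps)
  define h where "h = (\<lambda>y. f y + (-e) * (norm y)\<^sup>2)"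
  have "compact (closure S)" "closure S \<noteq> {}"
    using assms by (auto simp: compact_closure)
  moreover have "continuous_on (closure S) h"
    unfolding h_def by (intro continuous_intros cont)
  ultimately obtain y where y: "y \<in> closure S" "\<And>w. w \<in> closure S \<Longrightarrow> h y \<le> h w"
    using continuous_attains_inf by metis
  have xc: "x \<in> closure S" using \<open>x \<in> S\<close> closure_subset by auto
  have "y \<notin> frontier S"
  proof
    assume "y \<in> frontier S"
    moreover have "e * (norm y)\<^sup>2 \<le> e * R\<^sup>2"
      using R(2)[OF y(1)] e by (intro mult_left_mono power_mono) auto
    ultimately have "h y \<ge> f x / 2"
      using bd[of y] e unfolding h_def by auto
    moreover have "h x \<le> f x"
      unfolding h_def using e by simp
    ultimately show False
      using y(2)[OF xc] neg by auto
  qed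
  then have "y \<in> S"
    using y(1) closure_Un_frontier[of S] by blast
  have "has_laplacian h y (0 + (-e) * (2 * DIM('a)))"
    unfolding h_def
    by (intro has_laplacian_add has_laplacian_cmult has_laplacian_norm_square lap \<open>y \<in> S\<close>)
  then obtain D where D: "\<And>b. b \<in> Basis \<Longrightarrow> has_second_deriv h y b (D b)"
    "(-e) * (2 * DIM('a)) = (\<Sum>b\<in>(Basis::'a set). D b)"
    unfolding has_laplacian_def by auto
  have "0 \<le> D b" if "b \<in> Basis" for b
  proof (rule has_second_deriv_nonneg_at_local_min[OF D(1)[OF that]])
    have "((\<lambda>t. y + t *\<^sub>R b) \<longlongrightarrow> y + 0 *\<^sub>R b) (nhds 0)"
      by (intro tendsto_intros filterlim_ident)
    then have "\<forall>\<^sub>F t in nhds 0. y + t *\<^sub>R b \<in> S"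
      using \<open>y \<in> S\<close> \<open>open S\<close> by (intro topological_tendstoD) auto
    then show "\<forall>\<^sub>F t in nhds 0. h y \<le> h (y + t *\<^sub>R b)"
      by eventually_elim (use y(2) closure_subset in blast)
  qed
  then have "0 \<le> (\<Sum>b\<in>(Basis::'a set). D b)" by (intro sum_nonneg) auto
  moreover have "(-e) * (2 * DIM('a)) < 0" using e by simp
  ultimately show False using D(2) by linarith
qed

lemma has_derivative_along_line:
  fixes f :: "'a::euclidean_space \<Rightarrow> real"
  assumes "f differentiable (at (x + t *\<^sub>R v))"
  shows "((\<lambda>t. f (x + t *\<^sub>R v)) has_real_derivative frechet_derivative f (at (x + t *\<^sub>R v)) v) (at t)"
proof -
  have *: "(f has_derivative frechet_derivative f (at (x + t *\<^sub>R v))) (at (x + t *\<^sub>R v))"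
    using assms by (simp add: frechet_derivative_works)
  have "((\<lambda>t. x + t *\<^sub>R v) has_derivative (\<lambda>h. h *\<^sub>R v)) (at t)"
    by (auto intro!: derivative_eq_intros)
  from diff_chain_at[OF this *]
  have "((\<lambda>t. f (x + t *\<^sub>R v)) has_derivative (\<lambda>h. frechet_derivative f (at (x + t *\<^sub>R v)) (h *\<^sub>R v))) (at t)"
    by (simp add: o_def)
  moreover have "frechet_derivative f (at (x + t *\<^sub>R v)) (h *\<^sub>R v) = h * frechet_derivative f (at (x + t *\<^sub>R v)) v" for h
    using linear_scale[OF linear_frechet_derivative[OF assms]] by simp
  ultimately show ?thesis
    by (simp add: has_field_derivative_def mult.commute[of _ "frechet_derivative _ _ _"])
qed

lemma harmonic_on_has_laplacian:
  assumes "harmonic_on S f" "x \<in> S"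
  shows "has_laplacian f x 0"
proof -
  have S: "open S" and df: "\<And>y. y \<in> S \<Longrightarrow> f differentiable (at y)"
    and dp: "\<And>y b. b \<in> Basis \<Longrightarrow> y \<in> S \<Longrightarrow> partial_deriv b f differentiable (at y)"
    using assms(1) unfolding harmonic_on_def C2_on_def
    by (auto simp: differentiable_on_eq_differentiable_at)
  have "has_second_deriv f x b (partial_deriv b (partial_deriv b f) x)" if b: "b \<in> Basis" for b
    unfolding has_second_deriv_def
  proof (intro exI conjI)
    have "((\<lambda>t. x + t *\<^sub>R b) \<longlongrightarrow> x + 0 *\<^sub>R b) (nhds 0)"
      by (intro tendsto_intros filterlim_ident)
    then have "\<forall>\<^sub>F t in nhds 0. x + t *\<^sub>R b \<in> S"
      using assms(2) \<open>open S\<close> by (intro topological_tendstoD) auto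
    then show "\<forall>\<^sub>F t in nhds 0. ((\<lambda>t. f (x + t *\<^sub>R b)) has_real_derivative partial_deriv b f (x + t *\<^sub>R b)) (at t)"
      by eventually_elim (auto simp: partial_deriv_def intro!: has_derivative_along_line df)
    show "((\<lambda>t. partial_deriv b f (x + t *\<^sub>R b)) has_real_derivative partial_deriv b (partial_deriv b f) x) (at 0)"
      using has_derivative_along_line[of "partial_deriv b f" x 0 b] dp[OF b] assms(2)
      unfolding partial_deriv_def[of b "partial_deriv b f"] by simp
  qed
  then show ?thesis
    using assms unfolding has_laplacian_def harmonic_on_def laplacian_def
    by (intro exI[of _ "\<lambda>b. partial_deriv b (partial_deriv b f) x"]) auto
qed

section \<open>The mean value property and a Harnack inequality\<close>

lemma lborel_integral_affine:
  fixes f :: "'a::euclidean_space \<Rightarrow> real"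
  assumes [measurable]: "f \<in> borel_measurable borel" and c: "c \<noteq> 0"
  shows "(\<integral>x. f x \<partial>lborel) = \<bar>c\<bar> ^ DIM('a) * (\<integral>x. f (t + c *\<^sub>R x) \<partial>lborel)"
proof -
  have "(\<integral>x. f x \<partial>lborel)
      = (\<integral>x. f x \<partial>density (distr lborel borel (\<lambda>x. t + c *\<^sub>R x)) (\<lambda>_. ennreal (\<bar>c\<bar> ^ DIM('a))))"
    using lborel_affine[OF c, of t] by (simp add: ennreal_power)
  also have "\<dots> = (\<integral>x. \<bar>c\<bar> ^ DIM('a) * f (t + c *\<^sub>R x) \<partial>lborel)"
    by (subst integral_density) (auto simp: integral_distr)
  finally show ?thesis by simp
qed

text \<open>
  A translation does not change the integral, so the difference quotients of \<open>f\<close> in direction \<open>b\<close> have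
  integral zero; the Lipschitz bound dominates them, and the limit is the integral of the derivative.
  This replaces the divergence theorem. Differentiability almost everywhere suffices, which makes it
  applicable to functions that vanish on the unit sphere and are cut off outside it.
\<close>
lemma integral_directional_derivative_eq_0:
  fixes f f' :: "'a::euclidean_space \<Rightarrow> real"
  assumes [measurable]: "f \<in> borel_measurable borel" "f' \<in> borel_measurable borel"
    and supp: "\<And>x. x \<notin> cball 0 1 \<Longrightarrow> f x = 0"
    and lip: "\<And>x t. \<bar>f (x + t *\<^sub>R b) - f x\<bar> \<le> L * \<bar>t\<bar>"
    and deriv: "AE x in lborel. ((\<lambda>t. f (x + t *\<^sub>R b)) has_real_derivative f' x) (at 0)"
    and b: "norm b = 1"
  shows "(\<integral>x. f' x \<partial>lborel) = 0"
proof -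
  define T where "T = (\<lambda>i. inverse (real (Suc i)))"
  have T: "0 < T i" "T i \<le> 1" for i
    unfolding T_def by (auto simp: field_simps)
  have T0: "filterlim T (at 0) sequentially"
    unfolding T_def using LIMSEQ_inverse_real_of_nat by (intro filterlim_atI) auto
  have L: "L \<ge> 0" using lip[of 0 1] by simp
  have bound: "\<bar>f x\<bar> \<le> 3 * L * indicator (cball 0 1) x" for x
  proof (cases "x \<in> cball 0 1")
    case True
    have "norm (3 *\<^sub>R b) \<le> norm (x + 3 *\<^sub>R b) + norm x"
      using norm_triangle_ineq4[of "x + 3 *\<^sub>R b" x] by simp
    then have "x + 3 *\<^sub>R b \<notin> cball 0 1" using True b by simp
    with lip[of x 3] supp True show ?thesis by simp
  next
    case False
    with supp L show ?thesis by simp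
  qed
  have int: "integrable lborel f"
  proof (rule Bochner_Integration.integrable_bound)
    show "integrable lborel (\<lambda>x. 3 * L * indicator (cball 0 1) x :: real)"
      by (intro integrable_mult_right) (auto simp: emeasure_cball)
    show "AE x in lborel. norm (f x) \<le> norm (3 * L * indicator (cball 0 1) x :: real)"
      using bound L by (auto simp: abs_mult)
  qed auto
  have int_shift: "integrable lborel (\<lambda>x. f (x + t *\<^sub>R b))"
    "(\<integral>x. f (x + t *\<^sub>R b) \<partial>lborel) = (\<integral>x. f x \<partial>lborel)" for t
  proof -
    have d: "lborel = distr lborel borel (\<lambda>x::'a. x + t *\<^sub>R b)"
    proof -
      have "(\<lambda>x::'a. x + t *\<^sub>R b) = (+) (t *\<^sub>R b)" by (auto simp: add.commute)
      then show ?thesis using lborel_distr_plus[of "t *\<^sub>R b"] by simp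
    qed
    show "integrable lborel (\<lambda>x. f (x + t *\<^sub>R b))"
      using int by (subst (asm) d, subst (asm) integrable_distr_eq) auto
    show "(\<integral>x. f (x + t *\<^sub>R b) \<partial>lborel) = (\<integral>x. f x \<partial>lborel)"
      by (subst (2) d, subst integral_distr) auto
  qed
  define q where "q = (\<lambda>i x. (f (x + T i *\<^sub>R b) - f x) / T i)"
  have "(\<lambda>i. \<integral>x. q i x \<partial>lborel) \<longlonglongrightarrow> (\<integral>x. f' x \<partial>lborel)"
  proof (rule integral_dominated_convergence[where w="\<lambda>x. L * indicator (cball 0 2) x"])
    show "integrable lborel (\<lambda>x. L * indicator (cball 0 2) x :: real)"
      by (intro integrable_mult_right) (auto simp: emeasure_cball)
    show "AE x in lborel. (\<lambda>i. q i x) \<longlonglongrightarrow> f' x"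
      using deriv
    proof eventually_elim
      case (elim x)
      then have "((\<lambda>h. (f (x + h *\<^sub>R b) - f x) / h) \<longlongrightarrow> f' x) (at 0)"
        by (simp add: DERIV_def)
      from filterlim_compose[OF this T0] show ?case by (simp add: q_def)
    qed
    show "AE x in lborel. norm (q i x) \<le> L * indicator (cball 0 2) x" for i
    proof (intro AE_I2)
      fix x
      show "norm (q i x) \<le> L * indicator (cball 0 2) x"
      proof (cases "x \<in> cball 0 2")
        case True
        then show ?thesis using lip[of x "T i"] T[of i]
          by (simp add: q_def divide_le_eq)
      next
        case False
        have "norm x \<le> norm (x + T i *\<^sub>R b) + norm (T i *\<^sub>R b)"
          using norm_triangle_ineq4[of "x + T i *\<^sub>R b" "T i *\<^sub>R b"] by simp
        moreover have "norm (T i *\<^sub>R b) \<le> 1" using T[of i] b by simp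
        ultimately have "x + T i *\<^sub>R b \<notin> cball 0 1" "x \<notin> cball 0 1"
          using False by auto
        then show ?thesis using False by (simp add: q_def supp)
      qed
    qed
  qed (auto simp: q_def)
  moreover have "(\<integral>x. q i x \<partial>lborel) = 0" for i
    unfolding q_def using int int_shift by simp
  ultimately show ?thesis by (simp add: LIMSEQ_const_iff)
qed

lemma harmonic_onD:
  assumes "harmonic_on S u"
  shows "open S"
    and "y \<in> S \<Longrightarrow> u differentiable (at y)"
    and "b \<in> Basis \<Longrightarrow> y \<in> S \<Longrightarrow> partial_deriv b u differentiable (at y)"
    and "continuous_on S u"
    and "b \<in> Basis \<Longrightarrow> continuous_on S (partial_deriv b u)"
    and "b \<in> Basis \<Longrightarrow> continuous_on S (partial_deriv b (partial_deriv b u))"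
    and "y \<in> S \<Longrightarrow> (\<Sum>b\<in>Basis. partial_deriv b (partial_deriv b u) y) = 0"
  using assms unfolding harmonic_on_def C2_on_def laplacian_def
  by (auto simp: differentiable_on_eq_differentiable_at differentiable_imp_continuous_on)

lemma frechet_derivative_eq_sum_partial_deriv:
  fixes u :: "'a::euclidean_space \<Rightarrow> real"
  assumes "u differentiable (at x)"
  shows "frechet_derivative u (at x) v = (\<Sum>b\<in>Basis. (v \<bullet> b) * partial_deriv b u x)"
proof -
  have lin: "linear (frechet_derivative u (at x))" by (rule linear_frechet_derivative[OF assms])
  have "frechet_derivative u (at x) v = frechet_derivative u (at x) (\<Sum>b\<in>Basis. (v \<bullet> b) *\<^sub>R b)"
    by (simp add: euclidean_representation)
  also have "\<dots> = (\<Sum>b\<in>Basis. (v \<bullet> b) * partial_deriv b u x)"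
    by (simp add: linear_sum[OF lin] linear_scale[OF lin] partial_deriv_def)
  finally show ?thesis .
qed

lemma dilation_in_cball:
  fixes y :: "'a::real_normed_vector"
  assumes "0 \<le> s" "s \<le> R" "norm y \<le> 1"
  shows "a + s *\<^sub>R y \<in> cball a R"
proof -
  have "s * norm y \<le> R * 1" using assms by (intro mult_mono) auto
  then show ?thesis using assms by (simp add: dist_norm)
qed

lemma continuous_on_dilated:
  fixes h :: "'a::euclidean_space \<Rightarrow> real"
  assumes "continuous_on S h" "cball a R \<subseteq> S" "0 \<le> s" "s \<le> R"
  shows "continuous_on (cball 0 1) (\<lambda>y. h (a + s *\<^sub>R y))"
proof (rule continuous_on_compose2[OF assms(1)])
  show "(\<lambda>y. a + s *\<^sub>R y) ` cball 0 1 \<subseteq> S"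
    using dilation_in_cball[OF assms(3,4)] assms(2) by force
qed (intro continuous_intros)

lemma bounded_on_unit_cball:
  fixes h :: "'a::euclidean_space \<Rightarrow> real"
  assumes "continuous_on (cball 0 1) h"
  obtains B where "B \<ge> 0" "\<And>y. norm y \<le> 1 \<Longrightarrow> \<bar>h y\<bar> \<le> B"
proof -
  have "bounded (h ` cball 0 1)"
    using assms by (intro compact_imp_bounded compact_continuous_image) auto
  then obtain B where "B > 0" "\<And>x. x \<in> h ` cball 0 1 \<Longrightarrow> norm x \<le> B"
    unfolding bounded_pos by blast
  then show ?thesis by (intro that[of B]) auto
qed

lemma integrable_on_unit_cball:
  fixes h :: "'a::euclidean_space \<Rightarrow> real"
  assumes "continuous_on (cball 0 1) h"
  shows "integrable lborel (\<lambda>y. indicator (cball 0 1) y * h y)"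
  using borel_integrable_compact[OF _ assms] by (simp add: if_distrib indicator_def cong: if_cong) 

lemma measurable_on_cball:
  fixes h :: "'a::euclidean_space \<Rightarrow> real"
  assumes "continuous_on (cball a r) h"
  shows "(\<lambda>y. indicator (cball a r) y * h y) \<in> borel_measurable borel"
  using borel_measurable_continuous_on_indicator[OF _ assms] by simp

lemma AE_norm_neq_1: "AE y::'a::euclidean_space in lborel. norm y \<noteq> 1"
proof -
  from negligible_sphere[of "0::'a" 1] have "sphere (0::'a) 1 \<in> null_sets lborel"
    by (auto simp: null_sets_completion_iff negligible_iff_null_sets)
  from AE_not_in[OF this] show ?thesis by simp
qed

text \<open>
  The divergence of \<open>(1 - (norm y)\<^sup>2) \<nabla>u (a + s *\<^sub>R y)\<close> is
  \<open>- 2 * (y \<bullet> \<nabla>u (a + s *\<^sub>R y))\<close>, because the remaining term contains the Laplacian of \<open>u\<close>. The field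
  vanishes on the unit sphere, hence the divergence has integral zero over the ball.
\<close>
lemma integral_radial_derivative_eq_0:
  fixes u :: "'a::euclidean_space \<Rightarrow> real"
  assumes u: "harmonic_on S u" and sub: "cball a R \<subseteq> S" and s: "0 \<le> s" "s \<le> R"
  shows "(\<integral>y. indicator (cball 0 1) y * frechet_derivative u (at (a + s *\<^sub>R y)) y \<partial>lborel) = 0"
proof -
  note U = harmonic_onD[OF u]
  have inS: "a + s *\<^sub>R y \<in> S" if "norm y \<le> 1" for y
    using dilation_in_cball[OF s that] sub by auto
  define P where "P = (\<lambda>b y. partial_deriv b u (a + s *\<^sub>R y))"
  define F' where "F' = (\<lambda>b y. - 2 * (y \<bullet> b) * P b y
      + (1 - (norm y)\<^sup>2) * (s * partial_deriv b (partial_deriv b u) (a + s *\<^sub>R y)))"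
  have contP: "continuous_on (cball 0 1) (P b)" if "b \<in> Basis" for b
    unfolding P_def by (intro continuous_on_dilated[OF _ sub s] U that)
  have contF': "continuous_on (cball 0 1) (F' b)" if "b \<in> Basis" for b
    unfolding F'_def
    by (intro continuous_intros contP continuous_on_dilated[OF _ sub s] U that)
  have zero: "(\<integral>y. indicator (cball 0 1) y * F' b y \<partial>lborel) = 0" if b: "b \<in> Basis" for b
  proof -
    define F where "F = (\<lambda>y. (1 - (norm y)\<^sup>2) * P b y)"
    have F_deriv: "((\<lambda>t. F (y + t *\<^sub>R b)) has_real_derivative F' b (y + t *\<^sub>R b)) (at t)"
      if "norm (y + t *\<^sub>R b) \<le> 1" for y t
    proof -
      have lin: "linear (frechet_derivative (partial_deriv b u) (at (a + s *\<^sub>R (y + t *\<^sub>R b))))"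
        using U(3)[OF b inS[OF that]] by (rule linear_frechet_derivative)
      have eq: "a + s *\<^sub>R (y + t *\<^sub>R b) = (a + s *\<^sub>R y) + t *\<^sub>R (s *\<^sub>R b)" for t
        by (simp add: algebra_simps)
      have dP: "((\<lambda>t. P b (y + t *\<^sub>R b)) has_real_derivative
          s * partial_deriv b (partial_deriv b u) (a + s *\<^sub>R (y + t *\<^sub>R b))) (at t)"
        using has_derivative_along_line[of "partial_deriv b u" "a + s *\<^sub>R y" t "s *\<^sub>R b"]
          U(3)[OF b inS[OF that]] linear_scale[OF lin, of s b]
        unfolding P_def eq partial_deriv_def[of b "partial_deriv b u"] by simp
      have d1: "((\<lambda>t. 1 - (norm (y + t *\<^sub>R b))\<^sup>2) has_real_derivative
          - 2 * ((y + t *\<^sub>R b) \<bullet> b)) (at t)"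
        unfolding norm_square_along_basis[OF b] using b
        by (auto intro!: derivative_eq_intros simp: inner_add_left)
      show ?thesis
        unfolding F_def F'_def
        by (rule DERIV_cong[OF DERIV_mult[OF d1 dP]]) (simp add: algebra_simps)
    qed
    obtain M where M: "M \<ge> 0" "\<And>y. norm y \<le> 1 \<Longrightarrow> \<bar>P b y\<bar> \<le> M"
      using bounded_on_unit_cball[OF contP[OF b]] by blast
    obtain L where L: "L \<ge> 0" "\<And>y. norm y \<le> 1 \<Longrightarrow> \<bar>F' b y\<bar> \<le> L"
      using bounded_on_unit_cball[OF contF'[OF b]] by blast
    (* The factor 1 - |y|^2 vanishes on the sphere, so that a step from y across the sphere to z
       changes the cut-off function by at most a constant times the length of the step. *)
    have F_bound: "\<bar>F y\<bar> \<le> 2 * M * (norm z - norm y)" if "norm y \<le> 1" "norm z > 1" for y z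
    proof -
      have "1 - (norm y)\<^sup>2 = (1 + norm y) * (1 - norm y)"
        by (simp add: power2_eq_square algebra_simps)
      moreover have "(1 + norm y) * (1 - norm y) \<le> 2 * (norm z - norm y)"
        using that by (intro mult_mono) auto
      moreover have "0 \<le> (1 + norm y) * (1 - norm y)" using that by simp
      ultimately have "\<bar>1 - (norm y)\<^sup>2\<bar> \<le> 2 * (norm z - norm y)" by simp
      then have "\<bar>1 - (norm y)\<^sup>2\<bar> * \<bar>P b y\<bar> \<le> 2 * (norm z - norm y) * M"
        using M that by (intro mult_mono) auto
      then show ?thesis by (simp add: F_def abs_mult mult_ac)
    qed
    define f where "f = (\<lambda>y. indicator (cball 0 1) y * F y)"
    have nb: "norm b = 1" using b by simp
    show ?thesis
    proof (rule integral_directional_derivative_eq_0[where f=f and b=b and L="L + 2 * M"])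
      show "f \<in> borel_measurable borel"
        unfolding f_def F_def
        by (intro measurable_on_cball continuous_intros contP b)
      show "(\<lambda>y. indicator (cball 0 1) y * F' b y) \<in> borel_measurable borel"
        by (intro measurable_on_cball contF' b)
      show "f x = 0" if "x \<notin> cball 0 1" for x
        using that by (simp add: f_def)
      show "norm b = 1" by (fact nb)
      show "\<bar>f (x + t *\<^sub>R b) - f x\<bar> \<le> (L + 2 * M) * \<bar>t\<bar>" for x t
      proof -
        have tri: "\<bar>norm (x + t *\<^sub>R b) - norm x\<bar> \<le> \<bar>t\<bar>"
          using norm_triangle_ineq3[of "x + t *\<^sub>R b" x] nb by simp
        have M_le: "2 * M * c \<le> (L + 2 * M) * \<bar>t\<bar>" if "c \<le> \<bar>t\<bar>" for c
        proof -
          have "2 * M * c \<le> 2 * M * \<bar>t\<bar>" using that M by (intro mult_left_mono) auto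
          moreover have "0 \<le> L * \<bar>t\<bar>" using L by simp
          ultimately show ?thesis unfolding distrib_right by linarith
        qed
        (* Inside the ball the mean value theorem applies along the segment; a step that crosses the
           sphere is controlled by F_bound. *)
        consider "norm x \<le> 1" "norm (x + t *\<^sub>R b) \<le> 1" | "norm x \<le> 1" "norm (x + t *\<^sub>R b) > 1"
          | "norm x > 1" "norm (x + t *\<^sub>R b) \<le> 1" | "norm x > 1" "norm (x + t *\<^sub>R b) > 1"
          by linarith
        then show ?thesis
        proof cases
          case 1
          have seg: "norm (x + \<tau> *\<^sub>R b) \<le> 1" if "\<tau> \<in> closed_segment 0 t" for \<tau>
          proof -
            obtain v where "0 \<le> v" "v \<le> 1" "\<tau> = (1 - v) *\<^sub>R 0 + v *\<^sub>R t"
              using \<open>\<tau> \<in> closed_segment 0 t\<close> unfolding in_segment by blast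
            then have v: "0 \<le> v" "v \<le> 1" "\<tau> = v * t" by simp_all
            have "x + \<tau> *\<^sub>R b = (1 - v) *\<^sub>R x + v *\<^sub>R (x + t *\<^sub>R b)"
              using v by (simp add: algebra_simps)
            also have "\<dots> \<in> cball 0 1"
              using 1 v by (intro convexD[OF convex_cball]) auto
            finally show ?thesis by simp
          qed
          have "norm (F (x + t *\<^sub>R b) - F (x + 0 *\<^sub>R b)) \<le> L * norm (t - 0)"
          proof (rule field_differentiable_bound[where S="closed_segment 0 t" and f="\<lambda>t. F (x + t *\<^sub>R b)"])
            show "((\<lambda>t. F (x + t *\<^sub>R b)) has_field_derivative F' b (x + \<tau> *\<^sub>R b)) (at \<tau> within closed_segment 0 t)"
              if "\<tau> \<in> closed_segment 0 t" for \<tau>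
              using F_deriv[OF seg[OF that]] by (rule has_field_derivative_at_within)
            show "norm (F' b (x + \<tau> *\<^sub>R b)) \<le> L" if "\<tau> \<in> closed_segment 0 t" for \<tau>
              using L(2)[OF seg[OF that]] by simp
          qed auto
          then show ?thesis using 1 M by (simp add: f_def distrib_right add_increasing2)
        next
          case 2
          then show ?thesis using F_bound[of x "x + t *\<^sub>R b"] tri
              M_le[of "norm (x + t *\<^sub>R b) - norm x"] by (simp add: f_def)
        next
          case 3
          then show ?thesis using F_bound[of "x + t *\<^sub>R b" x] tri
              M_le[of "norm x - norm (x + t *\<^sub>R b)"] by (simp add: f_def)
        next
          case 4
          then show ?thesis using L M by (simp add: f_def)
        qed
      qed
      show "AE x in lborel. ((\<lambda>t. f (x + t *\<^sub>R b)) has_real_derivative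
          indicator (cball 0 1) x * F' b x) (at 0)"
        using AE_norm_neq_1
      proof eventually_elim
        case (elim x)
        have lim: "((\<lambda>t. norm (x + t *\<^sub>R b)) \<longlongrightarrow> norm (x + 0 *\<^sub>R b)) (nhds 0)"
          by (intro tendsto_intros filterlim_ident)
        show ?case
        proof (cases "norm x < 1")
          case True
          then have ev: "\<forall>\<^sub>F t in nhds 0. f (x + t *\<^sub>R b) = F (x + t *\<^sub>R b)"
            using order_tendstoD(2)[OF lim, of 1] by (auto simp: f_def elim: eventually_mono)
          show ?thesis
            using F_deriv[of x 0] True DERIV_cong_ev[OF refl ev refl] by simp
        next
          case False
          with elim have gt: "norm x > 1" by simp
          then have ev: "\<forall>\<^sub>F t in nhds 0. f (x + t *\<^sub>R b) = 0"
            using order_tendstoD(1)[OF lim, of 1] by (auto simp: f_def elim: eventually_mono)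
          show ?thesis
            using gt DERIV_cong_ev[OF refl ev refl] by simp
        qed
      qed
    qed
  qed
  have int: "integrable lborel (\<lambda>y. indicator (cball 0 1) y * F' b y)" if "b \<in> Basis" for b
    by (intro integrable_on_unit_cball contF' that)
  have "0 = (\<Sum>b\<in>Basis. \<integral>y. indicator (cball 0 1) y * F' b y \<partial>lborel)"
    using zero by simp
  also have "\<dots> = (\<integral>y. (\<Sum>b\<in>Basis. indicator (cball 0 1) y * F' b y) \<partial>lborel)"
    using int by (subst Bochner_Integration.integral_sum) auto
  also have "\<dots> = (\<integral>y. (- 2) * (indicator (cball 0 1) y * frechet_derivative u (at (a + s *\<^sub>R y)) y) \<partial>lborel)"
  proof (rule Bochner_Integration.integral_cong)
    fix y
    show "(\<Sum>b\<in>Basis. indicator (cball 0 1) y * F' b y)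
        = - 2 * (indicator (cball 0 1) y * frechet_derivative u (at (a + s *\<^sub>R y)) y)"
    proof (cases "norm y \<le> 1")
      case True
      have "(\<Sum>b\<in>Basis. F' b y) = - 2 * (\<Sum>b\<in>Basis. (y \<bullet> b) * P b y)
          + (1 - (norm y)\<^sup>2) * s * (\<Sum>b\<in>Basis. partial_deriv b (partial_deriv b u) (a + s *\<^sub>R y))"
        unfolding F'_def by (simp add: sum.distrib sum_distrib_left mult_ac sum_negf sum_subtractf)
      also have "\<dots> = - 2 * frechet_derivative u (at (a + s *\<^sub>R y)) y"
        using U(7)[OF inS[OF True]] frechet_derivative_eq_sum_partial_deriv[OF U(2)[OF inS[OF True]]]
        by (simp add: P_def)
      finally show ?thesis using True by simp
    qed simp
  qed simp
  finally show ?thesis by simp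
qed

text \<open>
  The integral of \<open>u (a + s *\<^sub>R y)\<close> over the unit ball has derivative zero in \<open>s\<close>, so its value at \<open>s = R\<close>
  equals its value at \<open>s = 0\<close>.
\<close>
lemma mean_value_property:
  fixes u :: "'a::euclidean_space \<Rightarrow> real"
  assumes u: "harmonic_on S u" and sub: "cball a R \<subseteq> S" and R: "R > 0"
  shows "(\<integral>x. indicator (cball a R) x * u x \<partial>lborel) = measure lborel (cball a R) * u a"
proof -
  note U = harmonic_onD[OF u]
  define g where "g = (\<lambda>s. \<integral>y. indicator (cball 0 1) y * u (a + s *\<^sub>R y) \<partial>lborel)"
  have inS: "a + s *\<^sub>R y \<in> S" if "norm y \<le> 1" "0 \<le> s" "s \<le> R" for y s
    using dilation_in_cball[of s R y a] that sub by auto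
  have int_u: "integrable lborel (\<lambda>y. indicator (cball 0 1) y * u (a + s *\<^sub>R y))"
    if "0 \<le> s" "s \<le> R" for s
    by (intro integrable_on_unit_cball continuous_on_dilated[OF U(4) sub] that)
  define D where "D = (\<lambda>s y. frechet_derivative u (at (a + s *\<^sub>R y)) y)"
  have D_eq: "D s y = (\<Sum>b\<in>Basis. (y \<bullet> b) * partial_deriv b u (a + s *\<^sub>R y))"
    if "norm y \<le> 1" "0 \<le> s" "s \<le> R" for s y
    unfolding D_def using frechet_derivative_eq_sum_partial_deriv[OF U(2)[OF inS[OF that]]] by simp
  obtain B where B: "B \<ge> 0" "\<And>s y. norm y \<le> 1 \<Longrightarrow> 0 \<le> s \<Longrightarrow> s \<le> R \<Longrightarrow> \<bar>D s y\<bar> \<le> B"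
  proof -
    define G where "G = (\<lambda>x. \<Sum>b\<in>Basis. \<bar>partial_deriv b u x\<bar>)"
    have "continuous_on (cball a R) G"
      unfolding G_def using U(5) sub by (intro continuous_intros) (auto intro: continuous_on_subset)
    then have "bounded (G ` cball a R)"
      by (intro compact_imp_bounded compact_continuous_image) auto
    then obtain B where B: "B > 0" "\<And>x. x \<in> cball a R \<Longrightarrow> norm (G x) \<le> B"
      unfolding bounded_pos by blast
    have "\<bar>D s y\<bar> \<le> B" if y: "norm y \<le> 1" and s: "0 \<le> s" "s \<le> R" for s y
    proof -
      have "\<bar>D s y\<bar> \<le> (\<Sum>b\<in>Basis. \<bar>(y \<bullet> b) * partial_deriv b u (a + s *\<^sub>R y)\<bar>)"
        unfolding D_eq[OF that] by (rule sum_abs)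
      also have "\<dots> \<le> G (a + s *\<^sub>R y)"
        unfolding G_def
      proof (intro sum_mono)
        fix b :: 'a assume "b \<in> Basis"
        then have "\<bar>y \<bullet> b\<bar> \<le> 1" using Basis_le_norm[of b y] y by linarith
        then show "\<bar>(y \<bullet> b) * partial_deriv b u (a + s *\<^sub>R y)\<bar> \<le> \<bar>partial_deriv b u (a + s *\<^sub>R y)\<bar>"
          by (simp add: abs_mult mult_left_le_one_le)
      qed
      also have "\<dots> \<le> B" using B(2)[OF dilation_in_cball[OF s y]] by simp
      finally show ?thesis .
    qed
    with B(1) show ?thesis by (intro that[of B]) auto
  qed
  have D_meas: "(\<lambda>y. indicator (cball 0 1) y * D s y) \<in> borel_measurable borel" if "0 \<le> s" "s \<le> R" for s
  proof -
    have "continuous_on (cball 0 1) (\<lambda>y. \<Sum>b\<in>Basis. (y \<bullet> b) * partial_deriv b u (a + s *\<^sub>R y))"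
      by (intro continuous_intros continuous_on_dilated[OF U(5) sub] that)
    then have "continuous_on (cball 0 1) (D s)"
      using D_eq that by (subst continuous_on_cong[OF refl]) auto
    then show ?thesis by (rule measurable_on_cball)
  qed
  have line: "((\<lambda>s. u (a + s *\<^sub>R y)) has_real_derivative D s y) (at s)"
    if "norm y \<le> 1" "0 \<le> s" "s \<le> R" for s y
    unfolding D_def by (intro has_derivative_along_line U inS that)
  have "(g has_field_derivative 0) (at s within {0..R})" if s: "s \<in> {0..R}" for s
    unfolding has_field_derivative_iff tendsto_at_iff_sequentially
  proof (intro allI impI)
    fix X :: "nat \<Rightarrow> real"
    assume X: "\<forall>i. X i \<in> {0..R} - {s}" and Xs: "X \<longlonglongrightarrow> s"
    define q where "q = (\<lambda>i y. (indicator (cball 0 1) y * u (a + X i *\<^sub>R y)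
        - indicator (cball 0 1) y * u (a + s *\<^sub>R y)) / (X i - s))"
    have X': "0 \<le> X i" "X i \<le> R" "X i \<noteq> s" for i using X by auto
    have s': "0 \<le> s" "s \<le> R" using s by auto
    have Xat: "filterlim X (at s) sequentially"
      using Xs X' by (intro filterlim_atI) auto
    have "(\<lambda>i. \<integral>y. q i y \<partial>lborel) \<longlonglongrightarrow> (\<integral>y. indicator (cball 0 1) y * D s y \<partial>lborel)"
    proof (rule integral_dominated_convergence[where w="\<lambda>x. B * indicator (cball 0 1) x"])
      show "integrable lborel (\<lambda>x::'a. B * indicator (cball 0 1) x :: real)"
        by (intro integrable_mult_right) (auto simp: emeasure_cball)
      show "(\<lambda>y. indicator (cball 0 1) y * D s y) \<in> borel_measurable lborel"
        using D_meas[OF s'] by simp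
      show "q i \<in> borel_measurable lborel" for i
        using borel_measurable_integrable[OF int_u[OF X'(1,2)[of i]]]
          borel_measurable_integrable[OF int_u[OF s']]
        unfolding q_def by measurable
      show "AE y in lborel. (\<lambda>i. q i y) \<longlonglongrightarrow> indicator (cball 0 1) y * D s y"
      proof (intro AE_I2)
        fix y :: 'a
        show "(\<lambda>i. q i y) \<longlonglongrightarrow> indicator (cball 0 1) y * D s y"
        proof (cases "norm y \<le> 1")
          case True
          have "((\<lambda>x. (u (a + x *\<^sub>R y) - u (a + s *\<^sub>R y)) / (x - s)) \<longlongrightarrow> D s y) (at s)"
            using line[OF True s'] by (simp add: has_field_derivative_iff)
          from filterlim_compose[OF this Xat] True show ?thesis by (simp add: q_def)
        qed (simp add: q_def)
      qed
      show "AE y in lborel. norm (q i y) \<le> B * indicator (cball 0 1) y" for i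
      proof (intro AE_I2)
        fix y :: 'a
        show "norm (q i y) \<le> B * indicator (cball 0 1) y"
        proof (cases "norm y \<le> 1")
          case True
          have "norm (u (a + X i *\<^sub>R y) - u (a + s *\<^sub>R y)) \<le> B * norm (X i - s)"
          proof (rule field_differentiable_bound[where S="{0..R}" and f="\<lambda>s. u (a + s *\<^sub>R y)"])
            show "((\<lambda>s. u (a + s *\<^sub>R y)) has_field_derivative D \<tau> y) (at \<tau> within {0..R})"
              if "\<tau> \<in> {0..R}" for \<tau>
              using line[OF True, of \<tau>] that by (auto intro: has_field_derivative_at_within)
            show "norm (D \<tau> y) \<le> B" if "\<tau> \<in> {0..R}" for \<tau>
              using B(2)[OF True, of \<tau>] that by simp
          qed (use X' s' in auto)
          then show ?thesis using True X'[of i] by (simp add: q_def divide_le_eq)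
        qed (simp add: q_def)
      qed
    qed
    moreover have "(\<integral>y. q i y \<partial>lborel) = (g (X i) - g s) / (X i - s)" for i
      unfolding q_def g_def using int_u[OF X'(1,2)[of i]] int_u[OF s'] by simp
    moreover have "(\<integral>y. indicator (cball 0 1) y * D s y \<partial>lborel) = 0"
      unfolding D_def by (rule integral_radial_derivative_eq_0[OF u sub s'])
    ultimately show "((\<lambda>y. (g y - g s) / (y - s)) \<circ> X) \<longlonglongrightarrow> 0"
      by (simp add: o_def)
  qed
  then obtain c where c: "\<And>s. s \<in> {0..R} \<Longrightarrow> g s = c"
    using has_field_derivative_zero_constant[of "{0..R}" g] by auto
  have gR: "g R = measure lborel (cball (0::'a) 1) * u a"
    using c[of R] c[of 0] R by (simp add: g_def)
  have "continuous_on (cball a R) u" using U(4) sub by (rule continuous_on_subset)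
  then have "(\<integral>x. indicator (cball a R) x * u x \<partial>lborel)
      = \<bar>R\<bar> ^ DIM('a) * (\<integral>y. indicator (cball a R) (a + R *\<^sub>R y) * u (a + R *\<^sub>R y) \<partial>lborel)"
    using R by (intro lborel_integral_affine measurable_on_cball) auto
  also have "(\<lambda>y. indicator (cball a R) (a + R *\<^sub>R y) * u (a + R *\<^sub>R y))
      = (\<lambda>y. indicator (cball 0 1) y * u (a + R *\<^sub>R y))"
    using R by (auto simp: indicator_def dist_norm mult_le_cancel_left1)
  also have "\<bar>R\<bar> ^ DIM('a) * (\<integral>y. indicator (cball 0 1) y * u (a + R *\<^sub>R y) \<partial>lborel)
      = measure lborel (cball a R) * u a"
    using R gR by (simp add: g_def content_cball)
  finally show ?thesis .
qed

text \<open>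
  The average of the nonnegative function \<open>K - u\<close> over \<open>cball y (2 * r)\<close> is at least \<open>1 / 2 ^ DIM('a)\<close>
  times its average over the smaller ball \<open>cball z r\<close>.
\<close>
lemma harnack_ball:
  fixes u :: "'a::euclidean_space \<Rightarrow> real"
  assumes u: "harmonic_on S u" and sub: "cball z (3 * r) \<subseteq> S" and r: "r > 0"
    and le: "\<And>x. x \<in> cball z (3 * r) \<Longrightarrow> u x \<le> K" and y: "dist z y \<le> r"
  shows "(K - u z) / 2 ^ DIM('a) \<le> K - u y"
proof -
  have cont: "continuous_on S u" by (rule harmonic_onD[OF u])
  have sub2: "cball y (2 * r) \<subseteq> cball z (3 * r)"
  proof
    fix x assume "x \<in> cball y (2 * r)"
    then show "x \<in> cball z (3 * r)" using y dist_triangle[of z x y] by simp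
  qed
  have sub1: "cball z r \<subseteq> cball y (2 * r)"
  proof
    fix x assume "x \<in> cball z r"
    then show "x \<in> cball y (2 * r)" using y dist_triangle[of y x z] by (simp add: dist_commute)
  qed
  have int: "integrable lborel (\<lambda>x. indicator (cball b t) x * u x)" if "cball b t \<subseteq> S" for b t
    using borel_integrable_compact[OF compact_cball continuous_on_subset[OF cont that]]
    by (simp add: if_distrib indicator_def cong: if_cong)
  have int1: "integrable lborel (\<lambda>x. indicator (cball b t) x :: real)" for b :: 'a and t
    by (intro integrable_real_indicator emeasure_bounded_finite bounded_cball) simp
  have intK: "integrable lborel (\<lambda>x. indicator (cball b t) x * (K - u x))"
    and mvp: "(\<integral>x. indicator (cball b t) x * (K - u x) \<partial>lborel) = measure lborel (cball b t) * (K - u b)"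
    if "cball b t \<subseteq> S" "t > 0" for b t
  proof -
    have eq: "indicator (cball b t) x * (K - u x)
        = indicator (cball b t) x * K - indicator (cball b t) x * u x" for x
      by (simp add: algebra_simps)
    show "integrable lborel (\<lambda>x. indicator (cball b t) x * (K - u x))"
      unfolding eq using int[OF that(1)] int1 by (intro Bochner_Integration.integrable_diff integrable_mult_left)
    show "(\<integral>x. indicator (cball b t) x * (K - u x) \<partial>lborel) = measure lborel (cball b t) * (K - u b)"
      unfolding eq using int[OF that(1)] int1 mean_value_property[OF u that]
      by (subst Bochner_Integration.integral_diff) (auto simp: algebra_simps)
  qed
  have s1: "cball z r \<subseteq> S" and s2: "cball y (2 * r) \<subseteq> S"
    using sub sub1 sub2 by auto
  have "measure lborel (cball z r) * (K - u z) \<le> measure lborel (cball y (2 * r)) * (K - u y)"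
    unfolding mvp[OF s1 r, symmetric] using r
    by (subst mvp[OF s2, symmetric], simp, intro integral_mono intK s1 s2)
       (use sub1 sub2 le in \<open>auto simp: indicator_def subset_iff\<close>)
  moreover have "0 < unit_ball_vol (real DIM('a)) * r ^ DIM('a)"
    using r by (intro mult_pos_pos) auto
  ultimately have "K - u z \<le> 2 ^ DIM('a) * (K - u y)"
    using r by (simp add: content_cball power_mult_distrib mult_ac)
  then show ?thesis by (simp add: field_simps)
qed

section \<open>Poisson kernels\<close>

lemma norm_power_eq_powr:
  fixes w :: "'a::euclidean_space"
  shows "norm w ^ DIM('a) = (norm w)\<^sup>2 powr (real DIM('a) / 2)"
proof (cases "w = 0")
  case False
  have "(norm w)\<^sup>2 powr (real DIM('a) / 2) = (norm w powr 2) powr (real DIM('a) / 2)"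
    by simp
  also have "\<dots> = norm w powr real DIM('a)"
    by (subst powr_powr) simp
  also have "\<dots> = norm w ^ DIM('a)"
    using False by (intro powr_realpow) simp
  finally show ?thesis ..
qed simp

text \<open>
  Up to a constant factor, the Poisson kernel of the ball of radius \<open>norm p\<close> about the origin with pole \<open>p\<close>
  on its boundary.
\<close>
definition poisson_kernel :: "'a \<Rightarrow> 'a::euclidean_space \<Rightarrow> real" where
  "poisson_kernel p z = ((norm p)\<^sup>2 - (norm z)\<^sup>2) / norm (z - p) ^ DIM('a)"

text \<open>
  With \<open>w = z - p\<close> and \<open>q = (norm w)\<^sup>2\<close> the kernel equals \<open>- (q + 2 * (w \<bullet> p)) * q powr \<beta>\<close>, where
  \<open>\<beta> = - DIM('a) / 2\<close>. Along a coordinate line \<open>q\<close> is quadratic and \<open>w \<bullet> p\<close> is affine, and the second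
  derivatives cancel in the sum exactly for this exponent.
\<close>
lemma poisson_kernel_harmonic:
  fixes p z :: "'a::euclidean_space"
  assumes "z \<noteq> p"
  shows "has_laplacian (poisson_kernel p) z 0"
proof -
  define w where "w = z - p"
  define \<beta> where "\<beta> = - (real DIM('a) / 2)"
  define Q where "Q = (norm w)\<^sup>2"
  have Q: "Q > 0" using assms by (simp add: Q_def w_def)
  define D where "D = (\<lambda>b. - (2 * Q powr \<beta> + 2 * (2 * (w \<bullet> b) + 2 * (p \<bullet> b)) * (\<beta> * Q powr (\<beta> - 1) * (2 * (w \<bullet> b)))
     + (Q + 2 * (w \<bullet> p)) * (\<beta> * (\<beta> - 1) * Q powr (\<beta> - 1 - 1) * (2 * (w \<bullet> b))\<^sup>2 + \<beta> * Q powr (\<beta> - 1) * 2)))"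
  have "has_second_deriv (poisson_kernel p) z b (D b)" if b: "b \<in> Basis" for b
  proof -
    define q where "q = (\<lambda>t. Q + 2 * t * (w \<bullet> b) + t\<^sup>2)"
    define l where "l = (\<lambda>t. w \<bullet> p + t * (p \<bullet> b))"
    have q_eq: "q t = (norm (w + t *\<^sub>R b))\<^sup>2" for t
      using b by (simp add: q_def Q_def norm_square_along_basis)
    have eq: "poisson_kernel p (z + t *\<^sub>R b) = - ((q t + 2 * l t) * q t powr \<beta>)" for t
    proof -
      have num: "(norm p)\<^sup>2 - (norm (z + t *\<^sub>R b))\<^sup>2 = - (q t + 2 * l t)"
        unfolding q_eq l_def w_def
        by (auto simp: power2_norm_eq_inner algebra_simps inner_commute)
      have den: "norm (z + t *\<^sub>R b - p) ^ DIM('a) = q t powr (real DIM('a) / 2)"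
        proof -
        have "z + t *\<^sub>R b - p = w + t *\<^sub>R b" by (simp add: w_def)
        then show ?thesis by (simp only: q_eq norm_power_eq_powr)
      qed
      show ?thesis
        unfolding poisson_kernel_def num den \<beta>_def powr_minus_divide
        by (simp only: times_divide_eq_right mult_1_right minus_divide_left)
    qed
    have qd: "(q has_real_derivative 2 * (w \<bullet> b) + 2 * t) (at t)" for t
      unfolding q_def by (auto intro!: derivative_eq_intros)
    have ld: "(l has_real_derivative p \<bullet> b) (at t)" for t
      unfolding l_def by (auto intro!: derivative_eq_intros)
    have pd: "((\<lambda>t. q t powr \<gamma>) has_real_derivative \<gamma> * q t powr (\<gamma> - 1) * (2 * (w \<bullet> b) + 2 * t)) (at t)"
      if "q t > 0" for t \<gamma>
      using DERIV_fun_powr[OF qd[of t] that, of \<gamma>] by simp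
    define g where "g = (\<lambda>t. - ((2 * (w \<bullet> b) + 2 * t + 2 * (p \<bullet> b)) * q t powr \<beta>
       + \<beta> * q t powr (\<beta> - 1) * (2 * (w \<bullet> b) + 2 * t) * (q t + 2 * l t)))"
    have "isCont q 0" by (rule DERIV_isCont[OF qd])
    then have "\<forall>\<^sub>F t in nhds 0. q t > 0"
      using Q unfolding isCont_def tendsto_at_iff_tendsto_nhds
      by (intro order_tendstoD) (auto simp: q_def)
    then have "\<forall>\<^sub>F t in nhds 0. ((\<lambda>t. poisson_kernel p (z + t *\<^sub>R b)) has_real_derivative g t) (at t)"
    proof eventually_elim
      case (elim t)
      show ?case
        unfolding eq g_def
        by (rule DERIV_minus[OF DERIV_mult[OF DERIV_add[OF qd DERIV_cmult[OF ld]] pd[OF elim]]])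
    qed
    moreover have "(g has_real_derivative D b) (at 0)"
    proof -
      have q0: "q 0 = Q" "l 0 = w \<bullet> p" by (auto simp: q_def l_def)
      have lin: "((\<lambda>t. c + 2 * t) has_real_derivative 2) (at 0)" for c :: real
        by (auto intro!: derivative_eq_intros)
      have lin': "((\<lambda>t. 2 * (w \<bullet> b) + 2 * t + 2 * (p \<bullet> b)) has_real_derivative 2) (at 0)"
        by (auto intro!: derivative_eq_intros)
      have "q 0 > 0" using Q q0 by simp
      note d = DERIV_minus[OF DERIV_add[OF DERIV_mult[OF lin' pd[OF this, of \<beta>]]
          DERIV_mult[OF DERIV_mult[OF DERIV_cmult[OF pd[OF this, of "\<beta> - 1"], of \<beta>] lin]
            DERIV_add[OF qd DERIV_cmult[OF ld]]]]]
      show ?thesis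
        unfolding g_def
        by (rule DERIV_cong[OF d]) (simp only: q0 D_def, algebra)
    qed
    ultimately show ?thesis
      unfolding has_second_deriv_def by blast
  qed
  moreover have "(\<Sum>b\<in>Basis. D b) = 0"
  proof -
    have ww: "(\<Sum>b\<in>Basis. (w \<bullet> b)\<^sup>2) = Q"
      unfolding Q_def power2_norm_eq_inner by (subst (2) euclidean_inner) (simp add: power2_eq_square)
    have pw: "(\<Sum>b\<in>Basis. (p \<bullet> b) * (w \<bullet> b)) = w \<bullet> p"
      using euclidean_inner[of w p] by (simp add: mult.commute)
    have lin: "(\<Sum>b\<in>(Basis::'a set). x + y * f b + y' * f' b)
        = real DIM('a) * x + y * (\<Sum>b\<in>Basis. f b) + y' * (\<Sum>b\<in>Basis. f' b)"
      for x y y' :: real and f f' :: "'a \<Rightarrow> real"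
      by (simp add: sum.distrib sum_distrib_left)
    have D: "D b = - (2 * Q powr \<beta> + 2 * \<beta> * (Q + 2 * (w \<bullet> p)) * Q powr (\<beta> - 1))
       + (- (8 * \<beta> * Q powr (\<beta> - 1) + 4 * \<beta> * (\<beta> - 1) * (Q + 2 * (w \<bullet> p)) * Q powr (\<beta> - 1 - 1))) * (w \<bullet> b)\<^sup>2
       + (- 8 * \<beta> * Q powr (\<beta> - 1)) * ((p \<bullet> b) * (w \<bullet> b))" for b
      unfolding D_def by algebra
    have "(\<Sum>b\<in>Basis. D b) = real DIM('a) * - (2 * Q powr \<beta> + 2 * \<beta> * (Q + 2 * (w \<bullet> p)) * Q powr (\<beta> - 1))
       + (- (8 * \<beta> * Q powr (\<beta> - 1) + 4 * \<beta> * (\<beta> - 1) * (Q + 2 * (w \<bullet> p)) * Q powr (\<beta> - 1 - 1))) * Q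
       + (- 8 * \<beta> * Q powr (\<beta> - 1)) * (w \<bullet> p)"
      unfolding D lin ww pw ..
    moreover have "real DIM('a) = - 2 * \<beta>" by (simp add: \<beta>_def)
    moreover have "Q powr \<beta> = Q * Q powr (\<beta> - 1)" "Q powr (\<beta> - 1) = Q * Q powr (\<beta> - 1 - 1)"
      using Q by (simp_all add: powr_diff powr_numeral power2_eq_square field_simps)
    ultimately show ?thesis by algebra
  qed
  ultimately show ?thesis
    unfolding has_laplacian_def by auto
qed

lemma continuous_on_poisson_kernel:
  assumes "p \<notin> X"
  shows "continuous_on X (poisson_kernel p)"
  unfolding poisson_kernel_def using assms by (intro continuous_intros) auto

lemma poisson_kernel_le:
  fixes p z :: "'a::euclidean_space"
  assumes "norm p \<le> 1" "norm z \<le> norm p" "DIM('a) = n + 1"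
  shows "poisson_kernel p z \<le> 2 * (norm p - norm z) / norm (z - p) ^ (n + 1)"
proof -
  have "(norm p)\<^sup>2 - (norm z)\<^sup>2 = (norm p + norm z) * (norm p - norm z)"
    by (simp add: power2_eq_square algebra_simps)
  also have "\<dots> \<le> 2 * (norm p - norm z)"
    using assms by (intro mult_right_mono) auto
  finally show ?thesis
    unfolding poisson_kernel_def using assms(3) by (simp add: divide_right_mono)
qed

text \<open>
  On the ball of radius \<open>\<rho>\<close>, and even on its boundary, the kernel whose pole is shifted outward by a
  distance \<open>s\<close> comparable with \<open>t = norm (z - \<rho> *\<^sub>R \<zeta>)\<close> is bounded below by a multiple of \<open>1 / t ^ n\<close>.
  Without the shift the kernel would vanish on the boundary.
\<close>
lemma poisson_kernel_ge_at_comparable_scale: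
  fixes \<zeta> z :: "'a::euclidean_space"
  assumes \<zeta>: "norm \<zeta> = 1" and \<rho>: "1 / 2 \<le> \<rho>" and z: "norm z \<le> \<rho>"
    and s: "norm (z - \<rho> *\<^sub>R \<zeta>) \<le> s" "s \<le> 8 * norm (z - \<rho> *\<^sub>R \<zeta>)" "s > 0"
    and d: "DIM('a) = n + 1"
  shows "1 / (9 ^ (n + 1) * norm (z - \<rho> *\<^sub>R \<zeta>) ^ n) \<le> poisson_kernel ((\<rho> + s) *\<^sub>R \<zeta>) z"
proof -
  define t where "t = norm (z - \<rho> *\<^sub>R \<zeta>)"
  define p where "p = (\<rho> + s) *\<^sub>R \<zeta>"
  have t: "t > 0" "t \<le> s" "s \<le> 8 * t" using s by (auto simp: t_def)
  have np: "norm p = \<rho> + s" using \<zeta> \<rho> s by (simp add: p_def)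
  have "t \<le> s * (2 * \<rho> + s)"
  proof -
    have "s * 1 \<le> s * (2 * \<rho> + s)" using \<rho> s by (intro mult_left_mono) auto
    then show ?thesis using t by linarith
  qed
  also have "\<dots> = (\<rho> + s)\<^sup>2 - \<rho>\<^sup>2" by (simp add: power2_eq_square algebra_simps)
  also have "\<dots> \<le> (norm p)\<^sup>2 - (norm z)\<^sup>2" using z by (simp add: np power_mono)
  finally have num: "t \<le> (norm p)\<^sup>2 - (norm z)\<^sup>2" .
  have "z \<noteq> p" using np z s by auto
  then have pos: "norm (z - p) > 0" by simp
  have "z - p = (z - \<rho> *\<^sub>R \<zeta>) - s *\<^sub>R \<zeta>" by (simp add: p_def algebra_simps)
  then have "norm (z - p) = norm ((z - \<rho> *\<^sub>R \<zeta>) - s *\<^sub>R \<zeta>)" by (rule arg_cong)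
  also have "\<dots> \<le> t + s"
    using norm_triangle_ineq4[of "z - \<rho> *\<^sub>R \<zeta>" "s *\<^sub>R \<zeta>"] \<zeta> s by (simp add: t_def)
  finally have "norm (z - p) \<le> t + s" .
  then have "norm (z - p) ^ (n + 1) \<le> (9 * t) ^ (n + 1)"
    using t by (intro power_mono) auto
  then have "t / (9 * t) ^ (n + 1) \<le> ((norm p)\<^sup>2 - (norm z)\<^sup>2) / norm (z - p) ^ (n + 1)"
    using num t pos by (intro frac_le zero_less_power) linarith+
  moreover have "t / (9 * t) ^ (n + 1) = 1 / (9 ^ (n + 1) * t ^ n)"
    using t by (simp add: power_mult_distrib)
  ultimately show ?thesis
    unfolding poisson_kernel_def using d by (simp add: t_def p_def)
qed

lemma poisson_kernel_nonneg:
  "norm z \<le> norm p \<Longrightarrow> 0 \<le> poisson_kernel p z"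
  unfolding poisson_kernel_def by (simp add: power_mono)

lemma poisson_kernel_at_0:
  fixes p :: "'a::euclidean_space"
  assumes "p \<noteq> 0" "DIM('a) = n + 1" "n \<ge> 1"
  shows "poisson_kernel p 0 = 1 / norm p ^ (n - 1)"
proof -
  have "norm p ^ (n + 1) = (norm p)\<^sup>2 * norm p ^ (n - 1)"
    using assms(3) by (simp flip: power_add)
  then show ?thesis using assms by (simp add: poisson_kernel_def)
qed

section \<open>Dyadic scales\<close>

lemma dyadic_scale_exists:
  fixes \<delta> t :: real
  assumes "\<delta> > 0" "\<delta> \<le> 8 * t" "t \<le> 2 ^ M * \<delta>"
  shows "\<exists>k\<le>M. t \<le> 2 ^ k * \<delta> \<and> 2 ^ k * \<delta> \<le> 8 * t"
proof -
  define k where "k = (LEAST k. t \<le> 2 ^ k * \<delta>)"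
  have k: "t \<le> 2 ^ k * \<delta>" unfolding k_def by (rule LeastI[of _ M]) (rule assms)
  have "k \<le> M" unfolding k_def by (rule Least_le) (rule assms)
  moreover have "2 ^ k * \<delta> \<le> 8 * t"
  proof (cases k)
    case 0
    then show ?thesis using assms by simp
  next
    case (Suc j)
    then have "\<not> t \<le> 2 ^ j * \<delta>" using not_less_Least[of j "\<lambda>k. t \<le> 2 ^ k * \<delta>"] k_def by simp
    moreover have "2 ^ k * \<delta> = 2 * (2 ^ j * \<delta>)" using Suc by simp
    ultimately show ?thesis using assms by linarith
  qed
  ultimately show ?thesis using k by blast
qed

text \<open>
  The number of dyadic scales between \<open>\<delta>\<close> and the diameter of the ball is the source of the logarithm.
\<close>
lemma dyadic_count_le_log:
  fixes \<delta> :: real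
  assumes "0 < \<delta>" "\<delta> < 1 / 2"
  obtains M where "2 \<le> 2 ^ M * \<delta>" "real (Suc M) \<le> 4 / ln 2 * ln (1 / \<delta>)"
proof -
  define M where "M = nat \<lceil>log 2 (2 / \<delta>)\<rceil>"
  have log_eq: "log 2 (2 / \<delta>) = 1 + ln (1 / \<delta>) / ln 2"
    using assms by (simp add: log_def ln_div add_divide_distrib diff_divide_distrib)
  have "ln 2 \<le> ln (1 / \<delta>)" using assms by (subst ln_le_cancel_iff) (auto simp: field_simps)
  then have one: "1 \<le> ln (1 / \<delta>) / ln 2" by (simp add: field_simps)
  have M: "log 2 (2 / \<delta>) \<le> real M" "real M \<le> log 2 (2 / \<delta>) + 1"
    using one unfolding M_def log_eq by linarith+
  have "2 / \<delta> = 2 powr log 2 (2 / \<delta>)" using assms by simp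
  also have "\<dots> \<le> 2 powr real M" using M by (intro powr_mono) auto
  also have "\<dots> = 2 ^ M" by (simp add: powr_realpow)
  finally have "2 \<le> 2 ^ M * \<delta>" using assms by (simp add: field_simps)
  moreover have "real (Suc M) \<le> 4 * (ln (1 / \<delta>) / ln 2)"
    using M(2) one unfolding log_eq of_nat_Suc by linarith
  then have "real (Suc M) \<le> 4 / ln 2 * ln (1 / \<delta>)" by simp
  ultimately show ?thesis by (rule that)
qed

section \<open>Comparison with dyadic sums of Poisson kernels\<close>

text \<open>
  The comparison argument. The explicit constant records that the factor depends on \<open>n\<close> alone;
  \<open>N\<close> is the number of dyadic scales used.
\<close>
lemma lower_bound_dyadic:
  fixes U :: "'a::euclidean_space \<Rightarrow> real"
  assumes n: "n \<ge> 1" and d: "DIM('a) = n + 1"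
    and U: "harmonic_on (ball 0 1) U" and U0: "U 0 = 0"
    and U_le: "\<And>z. z \<in> ball 0 1 \<Longrightarrow> U z \<le> 1 / (1 - norm z) ^ n"
    and \<delta>: "\<delta> = 1 - norm z0" "0 < \<delta>" "\<delta> < 1 / 2"
    and M: "2 \<le> 2 ^ M * \<delta>" and N: "N = Suc M"
  shows "- U z0 \<le> 2 ^ (n + 1) * (4 * (16 * (2 ^ (n + 2) * 9 ^ (n + 1))) ^ n * 9 ^ (n + 1) + 4 ^ n)
     * real N ^ (n + 1) / \<delta> ^ n"
proof -
  define r where "r = \<delta> / 4"
  define \<rho> where "\<rho> = 1 - 7 / 8 * \<delta>"
  define \<zeta> where "\<zeta> = (1 / norm z0) *\<^sub>R z0"
  define K where "K = 4 ^ n / \<delta> ^ n"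
  have nz0: "norm z0 = 1 - \<delta>" using \<delta> by simp
  then have "z0 \<noteq> 0" using \<delta> by auto
  have \<zeta>: "norm \<zeta> = 1" using \<open>z0 \<noteq> 0\<close> by (simp add: \<zeta>_def)
  have z0_eq: "z0 = (1 - \<delta>) *\<^sub>R \<zeta>" using nz0 \<delta> by (simp add: \<zeta>_def)
  have r: "r > 0" using \<delta> by (simp add: r_def)
  have \<rho>: "1 / 2 \<le> \<rho>" "\<rho> < 1" using \<delta> by (auto simp: \<rho>_def)
  have contU: "continuous_on (ball 0 1) U" by (rule harmonic_onD[OF U])

  have near: "norm x \<le> 1 - r" if "x \<in> cball z0 (3 * r)" for x
    using that norm_triangle_sub[of x z0] nz0 by (simp add: dist_norm norm_minus_commute r_def)
  have harnack: "(K - U z0) / 2 ^ (n + 1) \<le> K - U y" if "dist z0 y \<le> r" for y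
  proof -
    have "U x \<le> K" if "x \<in> cball z0 (3 * r)" for x
    proof -
      have "U x \<le> 1 / (1 - norm x) ^ n" using near[OF that] r by (intro U_le) simp
      also have "\<dots> \<le> 1 / r ^ n"
        using near[OF that] r by (intro divide_left_mono power_mono mult_pos_pos zero_less_power) auto
      also have "\<dots> = K" by (simp add: K_def r_def power_divide)
      finally show ?thesis .
    qed
    moreover have "cball z0 (3 * r) \<subseteq> ball 0 1" using near r by fastforce
    ultimately show ?thesis using harnack_ball[OF U _ r _ that, of K] d by simp
  qed
  (* m is a lower bound for -U on the whole ball of radius r about z0, by the Harnack inequality. *)
  define m where "m = (K - U z0) / 2 ^ (n + 1) - K"
  have m: "m \<le> - U y" if "dist z0 y \<le> r" for y using harnack[OF that] by (simp add: m_def)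

  (* The pole p lies strictly between z0 and the unit sphere, at distance r / 2 from z0, so the ball
     of radius r about z0 covers the singularity of P. The number eta is so small that
     eta * S 0 <= 1 / 2; the poles in S move away from p at dyadic distances. *)
  define p where "p = \<rho> *\<^sub>R \<zeta>"
  define s where "s = (\<lambda>k::nat. 2 ^ k * \<delta>)"
  define P where "P = poisson_kernel p"
  define S where "S = (\<lambda>z. \<Sum>k<N. poisson_kernel ((\<rho> + s k) *\<^sub>R \<zeta>) z)"
  define \<eta> where "\<eta> = 1 / (2 ^ (n + 1) * real N)"
  define v where "v = (\<lambda>z. P z + (- \<eta>) * S z)"
  define A where "A = (2 ^ (n + 2) * 9 ^ (n + 1) * real N) ^ n * 9 ^ (n + 1)"
  have "real N > 0" by (simp add: N)
  have s: "s k > 0" for k using \<delta> by (simp add: s_def)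
  have \<eta>: "\<eta> > 0" by (simp add: \<eta>_def N)
  have A: "A > 0" by (simp add: A_def N)
  have np: "norm p = \<rho>" using \<zeta> \<rho> by (simp add: p_def)
  have ns: "norm ((\<rho> + s k) *\<^sub>R \<zeta>) = \<rho> + s k" for k using \<zeta> \<rho> s[of k] by simp
  have pole_near: "norm (z0 - p) = \<delta> / 8"
  proof -
    have "z0 - p = (- \<delta> / 8) *\<^sub>R \<zeta>" by (simp add: z0_eq p_def \<rho>_def algebra_simps flip: scaleR_add_left)
    then show ?thesis using \<zeta> \<delta> by simp
  qed
  have t_ge: "\<delta> / 8 \<le> norm (z - p)" if "dist z0 z \<ge> r" for z
    using norm_triangle_ineq[of "z - p" "p - z0"] that pole_near
    by (simp add: dist_norm norm_minus_commute r_def)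
  have S_nonneg: "0 \<le> S z" if "norm z \<le> \<rho>" for z
    unfolding S_def using that s by (intro sum_nonneg poisson_kernel_nonneg) (simp add: ns add_increasing2 less_imp_le del: norm_scaleR)
  have S_ge: "1 / (9 ^ (n + 1) * norm (z - p) ^ n) \<le> S z" if z: "norm z \<le> \<rho>" "dist z0 z \<ge> r" for z
  proof -
    have "norm (z - p) \<le> 2" using norm_triangle_ineq4[of z p] z np \<rho> by simp
    then have "norm (z - p) \<le> 2 ^ M * \<delta>" using M by simp
    then obtain k where k: "k \<le> M" "norm (z - p) \<le> s k" "s k \<le> 8 * norm (z - p)"
      using dyadic_scale_exists[OF \<delta>(2), of "norm (z - p)" M] t_ge[OF z(2)] unfolding s_def by auto
    have "1 / (9 ^ (n + 1) * norm (z - p) ^ n) \<le> poisson_kernel ((\<rho> + s k) *\<^sub>R \<zeta>) z"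
      using poisson_kernel_ge_at_comparable_scale[OF \<zeta> \<rho>(1) z(1) _ _ s d] k unfolding p_def by blast
    also have "\<dots> \<le> S z"
      unfolding S_def using z s k(1)
      by (intro member_le_sum poisson_kernel_nonneg) (auto simp: ns N add_increasing2 less_imp_le simp del: norm_scaleR)
    finally show ?thesis .
  qed
  have P_le: "P z \<le> 2 * (\<rho> - norm z) / norm (z - p) ^ (n + 1)" if "norm z \<le> \<rho>" for z
    unfolding P_def using poisson_kernel_le[of p z n] that np \<rho> d by simp
  have P_0: "P 0 \<ge> 1"
  proof -
    have "p \<noteq> 0" using np \<rho> by auto
    then have "P 0 = 1 / \<rho> ^ (n - 1)"
      using poisson_kernel_at_0[OF _ d n, of p] np by (simp add: P_def)
    moreover have "\<rho> ^ (n - 1) \<le> 1" "0 < \<rho> ^ (n - 1)"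
      using \<rho> by (auto intro: power_le_one)
    ultimately show ?thesis by simp
  qed
  have S_0: "S 0 \<le> real N * 2 ^ n"
  proof -
    have "poisson_kernel ((\<rho> + s k) *\<^sub>R \<zeta>) 0 \<le> 2 ^ n" for k
    proof -
      have ge: "(1 / 2) ^ (n - 1) \<le> (\<rho> + s k) ^ (n - 1)"
        using \<rho> s[of k] by (intro power_mono) auto
      have "(\<rho> + s k) *\<^sub>R \<zeta> \<noteq> 0" using \<zeta> \<rho> s[of k] by auto
      from poisson_kernel_at_0[OF this d n]
      have "poisson_kernel ((\<rho> + s k) *\<^sub>R \<zeta>) 0 = 1 / (\<rho> + s k) ^ (n - 1)"
        unfolding ns .
      also have "\<dots> \<le> 1 / (1 / 2) ^ (n - 1)"
        using ge \<rho> s[of k] by (intro divide_left_mono mult_pos_pos zero_less_power) auto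
      also have "\<dots> = 2 ^ (n - 1)" by (simp add: power_one_over)
      also have "\<dots> \<le> 2 ^ n" by (intro power_increasing) auto
      finally show ?thesis .
    qed
    then have "S 0 \<le> (\<Sum>k<N. 2 ^ n)" unfolding S_def by (intro sum_mono)
    then show ?thesis by simp
  qed
  have v_0: "v 0 \<ge> 1 / 2"
  proof -
    have "\<eta> * S 0 \<le> \<eta> * (real N * 2 ^ n)" using S_0 \<eta> by (intro mult_left_mono) auto
    also have "\<dots> = 1 / 2" using \<open>real N > 0\<close> by (simp add: \<eta>_def)
    finally show ?thesis using P_0 by (simp add: v_def)
  qed

  define T where "T = {z. norm z \<le> \<rho> \<and> r \<le> dist z0 z}"
  define \<Omega> where "\<Omega> = {z. norm z < \<rho> \<and> r < dist z0 z \<and> 0 < v z}"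
  have cont: "continuous_on T P" "continuous_on T S"
  proof -
    have "p \<notin> T" using t_ge[of p] \<delta> by (auto simp: T_def)
    then show "continuous_on T P" unfolding P_def by (rule continuous_on_poisson_kernel)
    have "(\<rho> + s k) *\<^sub>R \<zeta> \<notin> T" for k using ns[of k] s[of k] by (auto simp: T_def)
    then show "continuous_on T S" unfolding S_def by (intro continuous_on_sum continuous_on_poisson_kernel)
  qed
  have contv: "continuous_on T v" unfolding v_def by (intro continuous_intros cont)
  have "closed T"
    unfolding T_def by (intro closed_Collect_conj closed_Collect_le continuous_intros)
  have sub: "closure \<Omega> \<subseteq> {z\<in>T. 0 \<le> v z}"
  proof (rule closure_minimal)
    show "\<Omega> \<subseteq> {z\<in>T. 0 \<le> v z}" by (auto simp: \<Omega>_def T_def)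
    have "closed (T \<inter> v -` {0..})"
      by (rule continuous_closed_preimage[OF contv \<open>closed T\<close>]) simp
    moreover have "T \<inter> v -` {0..} = {z\<in>T. 0 \<le> v z}" by auto
    ultimately show "closed {z\<in>T. 0 \<le> v z}" by simp
  qed
  have "open \<Omega>"
  proof -
    define T' where "T' = {z. norm z < \<rho> \<and> r < dist z0 z}"
    have "open T'" unfolding T'_def by (intro open_Collect_conj open_Collect_less continuous_intros)
    moreover have "continuous_on T' v" by (rule continuous_on_subset[OF contv]) (auto simp: T'_def T_def)
    ultimately have "open (T' \<inter> v -` {0<..})" by (intro continuous_open_preimage) auto
    moreover have "T' \<inter> v -` {0<..} = \<Omega>" by (auto simp: T'_def \<Omega>_def)
    ultimately show ?thesis by simp
  qed
  have "bounded \<Omega>"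
    by (rule bounded_subset[OF bounded_cball[of 0 \<rho>]]) (auto simp: \<Omega>_def)
  have "0 \<in> \<Omega>" using \<rho> v_0 nz0 \<delta> by (auto simp: \<Omega>_def r_def)

  have m_le: "m \<le> 4 * (8 / \<delta>) ^ n * (A * (real N * 2 ^ n))"
  proof (cases "m \<le> 0")
    case True
    have "0 \<le> 4 * (8 / \<delta>) ^ n * (A * (real N * 2 ^ n))" using A \<delta> by simp
    with True show ?thesis by linarith
  next
    case False
    (* The coefficient m' is chosen such that m' * v <= m on the part of the boundary of Omega where dist z0 z = r. *)
    define m' where "m' = m * (\<delta> / 8) ^ n / 2"
    have m': "m' > 0" using False \<delta> by (simp add: m'_def)
    define Z where "Z = (\<lambda>z. A * S z + ((-1) * U z + (- m') * v z))"
    have "0 \<le> Z 0"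
    proof (rule minimum_principle[OF \<open>open \<Omega>\<close> \<open>bounded \<Omega>\<close> _ _ _ \<open>0 \<in> \<Omega>\<close>])
      have "T \<subseteq> ball 0 1" using \<rho> by (auto simp: T_def)
      then have "continuous_on T Z"
        unfolding Z_def by (intro continuous_intros cont contv continuous_on_subset[OF contU])
      then show "continuous_on (closure \<Omega>) Z"
        by (rule continuous_on_subset) (use sub in auto)
      show "has_laplacian Z z 0" if "z \<in> \<Omega>" for z
      proof -
        have z: "norm z < \<rho>" "r < dist z0 z" using that by (auto simp: \<Omega>_def)
        have "z \<noteq> p" using z np by auto
        then have lP: "has_laplacian P z 0" unfolding P_def by (rule poisson_kernel_harmonic)
        have "z \<noteq> (\<rho> + s k) *\<^sub>R \<zeta>" for k using z ns[of k] s[of k] by auto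
        then have lS: "has_laplacian S z 0"
          unfolding S_def by (intro has_laplacian_sum poisson_kernel_harmonic) auto
        have lU: "has_laplacian U z 0"
          using z \<rho> by (intro harmonic_on_has_laplacian[OF U]) auto
        have "has_laplacian Z z (A * 0 + ((-1) * 0 + (- m') * (0 + (- \<eta>) * 0)))"
          unfolding Z_def v_def by (intro has_laplacian_add has_laplacian_cmult lP lS lU)
        then show ?thesis by simp
      qed
      show "0 \<le> Z z" if "z \<in> frontier \<Omega>" for z
      proof -
        have z: "z \<in> T" "0 \<le> v z" "z \<notin> \<Omega>"
          using that sub \<open>open \<Omega>\<close> by (auto simp: frontier_def interior_open)
        then have z': "norm z \<le> \<rho>" "r \<le> dist z0 z" by (auto simp: T_def)
        define t where "t = norm (z - p)"
        have t: "t > 0" "\<delta> / 8 \<le> t" using t_ge[OF z'(2)] \<delta> by (auto simp: t_def)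
        have S: "1 / (9 ^ (n + 1) * t ^ n) \<le> S z" using S_ge[OF z'] by (simp add: t_def)
        moreover have "0 < 1 / (9 ^ (n + 1) * t ^ n)" using t by simp
        ultimately have S_pos: "S z > 0" by linarith
        have Pz: "P z \<le> 2 * (\<rho> - norm z) / t ^ (n + 1)" using P_le[OF z'(1)] by (simp add: t_def)
        show ?thesis
        proof (cases "dist z0 z = r")
          case True
          have "\<rho> - norm z \<le> t"
            using norm_triangle_sub[of p z] np by (simp add: t_def norm_minus_commute)
          then have "2 * (\<rho> - norm z) / t ^ (n + 1) \<le> 2 * t / t ^ (n + 1)"
            using t by (intro divide_right_mono) auto
          also have "\<dots> = 2 / t ^ n" using t by simp
          also have "\<dots> \<le> 2 / (\<delta> / 8) ^ n"
            using t \<delta> by (intro divide_left_mono power_mono mult_pos_pos zero_less_power) auto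
          finally have "P z \<le> 2 / (\<delta> / 8) ^ n" using Pz by linarith
          moreover have "0 \<le> \<eta> * S z" using \<eta> S_pos by simp
          ultimately have "v z \<le> 2 / (\<delta> / 8) ^ n" by (simp add: v_def)
          then have "m' * v z \<le> m' * (2 / (\<delta> / 8) ^ n)" using m' by (intro mult_left_mono) auto
          also have "\<dots> = m" using \<delta> by (simp add: m'_def)
          finally have "m' * v z \<le> - U z" using m[of z] True by simp
          moreover have "0 \<le> A * S z" using A S_pos by simp
          ultimately show ?thesis by (simp add: Z_def)
        next
          case False
          (* On the sphere of radius rho the kernel P is zero while S is positive, so v < 0 there:
             this sphere does not meet the boundary of Omega. *)
          have "norm z < \<rho>"
          proof (rule ccontr)
            assume "\<not> norm z < \<rho>"
            then have "P z \<le> 0" using Pz z' by simp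
            moreover have "0 < \<eta> * S z" using \<eta> S_pos by simp
            ultimately show False using z(2) by (simp add: v_def)
          qed
          with z z' False have "v z = 0" by (auto simp: \<Omega>_def)
          then have "\<eta> * S z = P z" by (simp add: v_def)
          (* The equality P = eta * S forces rho - |z| to be at least of order eta * t, and this turns the
             hypothesis on U into a bound by A * S. *)
          have "\<eta> * (1 / (9 ^ (n + 1) * t ^ n)) \<le> \<eta> * S z"
            using S \<eta> by (intro mult_left_mono) auto
          also have "\<dots> \<le> 2 * (\<rho> - norm z) / t ^ (n + 1)" using \<open>\<eta> * S z = P z\<close> Pz by simp
          finally have "\<eta> / 9 ^ (n + 1) * t \<le> 2 * (\<rho> - norm z)"
            using t by (simp add: field_simps)
          moreover have "\<rho> - norm z \<le> 1 - norm z" using \<rho> by simp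
          ultimately have gap: "\<eta> / 9 ^ (n + 1) * t / 2 \<le> 1 - norm z" by simp
          have gap_pos: "0 < \<eta> / 9 ^ (n + 1) * t / 2" using \<eta> t by simp
          have "U z \<le> 1 / (1 - norm z) ^ n" using z' \<rho> by (intro U_le) auto
          also have "\<dots> \<le> 1 / (\<eta> / 9 ^ (n + 1) * t / 2) ^ n"
            using gap gap_pos by (intro divide_left_mono power_mono mult_pos_pos zero_less_power) auto
          also have "\<eta> / 9 ^ (n + 1) * t / 2 = t / (2 ^ (n + 2) * 9 ^ (n + 1) * real N)"
            by (simp add: \<eta>_def)
          also have "1 / (t / (2 ^ (n + 2) * 9 ^ (n + 1) * real N)) ^ n = A * (1 / (9 ^ (n + 1) * t ^ n))"
            unfolding A_def power_divide by simp
          also have "\<dots> \<le> A * S z" using S A by (intro mult_left_mono) auto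
          finally show ?thesis using \<open>v z = 0\<close> by (simp add: Z_def)
        qed
      qed
    qed
    then have "m' * v 0 \<le> A * S 0" using U0 by (simp add: Z_def)
    moreover have "m' * (1 / 2) \<le> m' * v 0" using v_0 m' by (intro mult_left_mono) auto
    moreover have "A * S 0 \<le> A * (real N * 2 ^ n)" using S_0 A by (intro mult_left_mono) auto
    ultimately have "m' \<le> 2 * (A * (real N * 2 ^ n))" by linarith
    then have "m' * (2 * (8 / \<delta>) ^ n) \<le> 2 * (A * (real N * 2 ^ n)) * (2 * (8 / \<delta>) ^ n)"
      using \<delta> by (intro mult_right_mono) auto
    moreover have "m' * (2 * (8 / \<delta>) ^ n) = m"
      using \<delta> by (simp add: m'_def power_divide)
    ultimately show ?thesis by (simp add: mult_ac)
  qed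
  have "4 * (8 / \<delta>) ^ n * (A * (real N * 2 ^ n))
      = 4 * (16 * (2 ^ (n + 2) * 9 ^ (n + 1))) ^ n * 9 ^ (n + 1) * real N ^ (n + 1) / \<delta> ^ n"
  proof -
    define E F :: real where "E = 2 ^ (n + 2) * 9 ^ (n + 1)" and "F = 9 ^ (n + 1)"
    have A_eq: "A = E ^ n * real N ^ n * F"
      unfolding A_def E_def F_def by (simp only: power_mult_distrib)
    have "(16 * E) ^ n = ((8 * 2) * E) ^ n" by simp
    also have "\<dots> = 8 ^ n * 2 ^ n * E ^ n" by (simp only: power_mult_distrib)
    finally have E_eq: "(16 * E) ^ n = 8 ^ n * 2 ^ n * E ^ n" .
    (* The powers are treated as atoms. *)
    have "4 * (a / d) * (e * x * f * (y * b)) = 4 * (a * b * e) * f * (x * y) / d"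
      for a b d e f x y :: real by simp
    then show ?thesis
      unfolding E_def[symmetric] unfolding F_def[symmetric]
      unfolding A_eq E_eq power_divide power_add power_one_right .
  qed
  with m_le have m_le': "m \<le> 4 * (16 * (2 ^ (n + 2) * 9 ^ (n + 1))) ^ n * 9 ^ (n + 1) * real N ^ (n + 1) / \<delta> ^ n"
    by simp
  have "1 \<le> real N ^ (n + 1)" by (rule one_le_power) (simp add: N)
  then have "4 ^ n * 1 \<le> 4 ^ n * real N ^ (n + 1)" by (intro mult_left_mono) auto
  then have K_le: "K \<le> 4 ^ n * real N ^ (n + 1) / \<delta> ^ n"
    unfolding K_def using \<delta> by (intro divide_right_mono) auto
  have "0 \<le> K" using \<delta> by (simp add: K_def)
  then have "- U z0 \<le> 2 ^ (n + 1) * (m + K)"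
    by (simp add: m_def)
  also have "\<dots> \<le> 2 ^ (n + 1) * (4 * (16 * (2 ^ (n + 2) * 9 ^ (n + 1))) ^ n * 9 ^ (n + 1) * real N ^ (n + 1) / \<delta> ^ n
      + 4 ^ n * real N ^ (n + 1) / \<delta> ^ n)"
    using m_le' K_le by (intro mult_left_mono add_mono) auto
  also have "\<dots> = 2 ^ (n + 1) * (4 * (16 * (2 ^ (n + 2) * 9 ^ (n + 1))) ^ n * 9 ^ (n + 1) + 4 ^ n)
     * real N ^ (n + 1) / \<delta> ^ n"
  proof -
    have "c * (a * x / d + b * x / d) = c * (a + b) * x / d" for a b c d x :: real
      by (simp add: distrib_left distrib_right add_divide_distrib)
    then show ?thesis .
  qed
  finally show ?thesis .
qed

theorem theorem2:
  fixes n :: nat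
  assumes "n \<ge> 1" and "CARD('d::finite) = n + 1"
  shows "\<exists>C::real. \<forall>U :: real ^ 'd \<Rightarrow> real.
           harmonic_on (ball 0 1) U \<longrightarrow>
           U 0 = 0 \<longrightarrow>
           (\<forall>z\<in>ball 0 1. U z \<le> 1 / (1 - norm z) ^ n) \<longrightarrow>
           (\<forall>z\<in>ball 0 1. norm z > 1 / 2 \<longrightarrow>
              \<bar>U z\<bar> \<le> C * (1 / (1 - norm z) ^ n) * ln (1 / (1 - norm z)) ^ (n + 1))"
proof -
  define C1 :: real
    where "C1 = 2 ^ (n + 1) * (4 * (16 * (2 ^ (n + 2) * 9 ^ (n + 1))) ^ n * 9 ^ (n + 1) + 4 ^ n)"
  define C :: real where "C = C1 * (4 / ln 2) ^ (n + 1)"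
  have C1: "C1 \<ge> 1"
  proof -
    have "(1::real) \<le> 2 ^ (n + 1)" "(1::real) \<le> 4 ^ n" by (rule one_le_power, simp)+
    moreover have "(0::real) \<le> 4 * (16 * (2 ^ (n + 2) * 9 ^ (n + 1))) ^ n * 9 ^ (n + 1)" by simp
    ultimately have "1 * 1 \<le> C1"
      unfolding C1_def by (intro mult_mono) linarith+
    then show ?thesis by simp
  qed
  have "\<bar>U z\<bar> \<le> C * (1 / (1 - norm z) ^ n) * ln (1 / (1 - norm z)) ^ (n + 1)"
    if U: "harmonic_on (ball 0 1) U" "U 0 = 0" "\<forall>z\<in>ball 0 1. U z \<le> 1 / (1 - norm z) ^ n"
      and z: "z \<in> ball 0 1" "norm z > 1 / 2" for U :: "real ^ 'd \<Rightarrow> real" and z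
  proof -
    define \<delta> where "\<delta> = 1 - norm z"
    have \<delta>: "0 < \<delta>" "\<delta> < 1 / 2" using z by (auto simp: \<delta>_def)
    obtain M where M: "2 \<le> 2 ^ M * \<delta>" "real (Suc M) \<le> 4 / ln 2 * ln (1 / \<delta>)"
      using dyadic_count_le_log[OF \<delta>] by blast
    have d: "DIM(real ^ 'd) = n + 1" using assms by simp
    have "real (Suc M) ^ (n + 1) \<le> (4 / ln 2 * ln (1 / \<delta>)) ^ (n + 1)"
      using M(2) by (intro power_mono) auto
    also have "\<dots> = (4 / ln 2) ^ (n + 1) * ln (1 / \<delta>) ^ (n + 1)" by (rule power_mult_distrib)
    finally have "C1 * real (Suc M) ^ (n + 1) / \<delta> ^ n
        \<le> C1 * ((4 / ln 2) ^ (n + 1) * ln (1 / \<delta>) ^ (n + 1)) / \<delta> ^ n"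
      using C1 \<delta> by (intro divide_right_mono mult_left_mono) auto
    also have "\<dots> = C * (1 / \<delta> ^ n) * ln (1 / \<delta>) ^ (n + 1)" by (simp add: C_def)
    finally have bound: "C1 * real (Suc M) ^ (n + 1) / \<delta> ^ n \<le> C * (1 / \<delta> ^ n) * ln (1 / \<delta>) ^ (n + 1)" .
    have "- U z \<le> C1 * real (Suc M) ^ (n + 1) / \<delta> ^ n"
      unfolding C1_def using lower_bound_dyadic[OF assms(1) d U(1,2) _ \<delta>_def \<delta> M(1) refl] U(3) by blast
    moreover have "U z \<le> C1 * real (Suc M) ^ (n + 1) / \<delta> ^ n"
    proof -
      have "1 * 1 \<le> C1 * real (Suc M) ^ (n + 1)"
        using C1 by (intro mult_mono one_le_power) auto
      then have "1 / \<delta> ^ n \<le> C1 * real (Suc M) ^ (n + 1) / \<delta> ^ n"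
        using \<delta> by (intro divide_right_mono) auto
      then show ?thesis using U(3) z(1) unfolding \<delta>_def by fastforce
    qed
    ultimately show ?thesis using bound unfolding \<delta>_def by linarith
  qed
  then show ?thesis by blast
qed

end
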